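(* Let $k\in\{4,5\}$ and let $n\ge1$ be such that every prime factor of $n$ is greater than $2k(k-1)$. Let $A,B$ be $n\times n$ $0$-$1$ circulants of weight $k$. Then the following are equivalent: (1) There exist $u,v\in\mathbb{Z}/n\mathbb{Z}$ with $\gcd(u,n)=1$ such that $S_A=uS_B+v$. (2) There are $n\times n$ permutation matrices $P,Q$ such that $A=PBQ$. (3) There is an $n\times n$ permutation matrix $P$ such that $AA^T=PBB^TP^{-1}$. (4) The complex matrices $AA^T$ and $BB^T$ are similar.
   Context: Rows and columns of $n\times n$ matrices are indexed by $0,\dots,n-1$. A $0$-$1$ circulant is an $n\times n$ matrix with entries in $\{0,1\}$ whose $(i,j)$ entry depends only on $j-i\bmod n$. For such $A$, $S_A\subseteq\mathbb{Z}/n\mathbb{Z}$ is the set of columns in which the top row has entry $1$ (so $A_{i,j}=1$ iff $j-i\in S_A$), and the weight of $A$ is $|S_A|$. $A^T$ is the transpose. *)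

theory Defs
  imports
    "Jordan_Normal_Form.Matrix"
    "HOL-Combinatorics.Permutations"
    "HOL-Computational_Algebra.Primes"
begin

text \<open>Elements of \<open>\<int>/n\<int>\<close> are represented by the natural numbers below \<open>n\<close>.\<close>

definition zero_one_circulant :: "nat \<Rightarrow> 'a::zero_neq_one mat \<Rightarrow> bool" where
  "zero_one_circulant n A \<longleftrightarrow>
     A \<in> carrier_mat n n \<and>
     (\<forall>i<n. \<forall>j<n. A $$ (i, j) \<in> {0, 1}) \<and>
     (\<forall>i<n. \<forall>j<n. \<forall>i'<n. \<forall>j'<n.
        (int j - int i) mod int n = (int j' - int i') mod int n \<longrightarrow>
        A $$ (i, j) = A $$ (i', j'))"

definition circulant_support :: "'a::zero_neq_one mat \<Rightarrow> nat set" where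
  "circulant_support A = {j. j < dim_col A \<and> A $$ (0, j) = 1}"

definition circulant_weight :: "'a::zero_neq_one mat \<Rightarrow> nat" where
  "circulant_weight A = card (circulant_support A)"

definition affine_image_mod :: "nat \<Rightarrow> nat \<Rightarrow> nat \<Rightarrow> nat set \<Rightarrow> nat set" where
  "affine_image_mod n u v S = (\<lambda>s. (u * s + v) mod n) ` S"

definition permutation_mat :: "nat \<Rightarrow> 'a::zero_neq_one mat \<Rightarrow> bool" where
  "permutation_mat n P \<longleftrightarrow>
     (\<exists>\<pi>. \<pi> permutes {..<n} \<and> P = mat n n (\<lambda>(i, j). if j = \<pi> i then 1 else 0))"

end

theory Submission
  imports
    Defs
    "Jordan_Normal_Form.Char_Poly"
    "HOL-Computational_Algebra.Field_as_Ring"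
    "HOL-Number_Theory.Cong"
begin

text \<open>
  The substance is that similarity of \<open>A A\<^sup>T\<close> and \<open>B B\<^sup>T\<close> forces the supports to be affinely equivalent.
  Comparing eigenvalues for the Fourier basis gives some \<open>j\<close> for which the sum of the \<open>\<zeta>\<close>-powers of all
  differences \<open>a - a'\<close> equals that of all \<open>j (b - b')\<close>. This is a vanishing sum of at most \<open>2 k (k - 1)\<close> signed
  roots of unity, fewer than any prime factor of \<open>n\<close>, so it is trivial: the two multisets of differences agree
  modulo \<open>n\<close>. By symmetry \<open>j\<close> may be replaced by a unit, and it remains to see that two \<open>k\<close>-sets with the same
  multiset of differences agree up to sign and translation.

  Modulo a prime this follows from Newton's identities: after centring, the even power sums of the
  differences determine \<open>e\<^sub>2\<close>, \<open>e\<^sub>4\<close>, \<open>e\<^sub>3\<^sup>2\<close>, \<open>e\<^sub>3 e\<^sub>5\<close> and \<open>e\<^sub>5\<^sup>2\<close>, hence all elementary symmetric functions up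
  to a common sign of the odd ones. To pass to composite \<open>n\<close>, fix a matching of the differences.
  By the prime case, a solution modulo \<open>p\<close> of the resulting linear system is governed by a system whose rows are sums of
  two signed incidence rows; its minors are at most \<open>2\<^sup>k < p\<close> in absolute value, so the solution lifts to an
  integer solution. Inductively all solutions modulo \<open>n\<close> lift to integers, where the prime case for one huge prime
  concludes.
\<close>

section \<open>Lifting solutions of linear congruences\<close>

text \<open>The prime case cannot be repeated at each prime factor of \<open>n\<close> and glued:
  every prime brings its own sign and its own permutation, and modulo a composite number a product
  of linear factors does not determine its roots. What all primes share is the matching of the
  differences. Once it is fixed, the two sequences satisfy one homogeneous linear system, the same
  at every stage of the induction and over the integers.

  That system has \<open>2 * k\<close> unknowns, for which the determinant estimate would only give
  \<open>2 ^ (2 * k)\<close>, beyond what is assumed about the primes. The prime case expresses one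
  sequence by the other modulo \<open>p\<close>, which leaves \<open>k\<close> unknowns. The number
  \<open>2 * k * (k - 1)\<close> counts the off-diagonal pairs on both sides of the eigenvalue
  equation; its values 24 and 40 also exceed \<open>2 ^ k\<close>, that is 16 and 32, and 13, the
  largest prime to be inverted in the Newton step.\<close>

definition signed_incidence_row :: "nat \<Rightarrow> (nat \<Rightarrow> int) \<Rightarrow> bool" where
  "signed_incidence_row n g \<longleftrightarrow>
     (\<forall>j<n. g j \<in> {-1, 0, 1}) \<and> (\<forall>i<n. \<forall>j<n. g i = g j \<and> g i \<noteq> 0 \<longrightarrow> i = j)"

text \<open>At most one entry is \<open>1\<close> and at most one is \<open>-1\<close>, so a nonzero
  row is a signed unit vector or the row of an edge in the incidence matrix of a directed graph. The
  hypothesis \<open>many\<close> rules out the unit vector.\<close>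

lemma signed_incidence_row_sum_zero:
  assumes g: "signed_incidence_row n g"
    and many: "\<And>i. i < n \<Longrightarrow> g i \<noteq> 0 \<Longrightarrow> \<exists>j<n. j \<noteq> i \<and> g j \<noteq> 0"
  shows "(\<Sum>j<n. g j) = 0"
proof (cases "\<exists>i<n. g i \<noteq> 0")
  case True
  then obtain i where i: "i < n" "g i \<noteq> 0" by blast
  obtain j where j: "j < n" "j \<noteq> i" "g j \<noteq> 0" using many[OF i] by blast
  have vals: "g x = -1 \<or> g x = 0 \<or> g x = 1" if "x < n" for x
    using g that unfolding signed_incidence_row_def by auto
  have uniq: "x = y" if "x < n" "y < n" "g x = g y" "g x \<noteq> 0" for x y
    using g that unfolding signed_incidence_row_def by blast
  have gij: "g i = - g j" using vals[OF i(1)] vals[OF j(1)] uniq[of i j] i j by auto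
  have zero: "g x = 0" if "x < n" "x \<noteq> i" "x \<noteq> j" for x
    using vals[OF that(1)] vals[OF i(1)] gij uniq[of x i] uniq[of x j] i j that by auto
  have "(\<Sum>x<n. g x) = (\<Sum>x\<in>{i, j}. g x)"
    by (rule sum.mono_neutral_right) (use i j zero in auto)
  also have "\<dots> = 0" using j gij by simp
  finally show ?thesis .
qed auto

text \<open>Incidence matrices of directed graphs are totally unimodular. A row with at most one
  nonzero entry gives a Laplace expansion with a single term; otherwise all rows sum to zero and the
  all-ones vector lies in the kernel.\<close>

lemma abs_det_signed_incidence_le_1:
  assumes "A \<in> carrier_mat n n" "\<And>i. i < n \<Longrightarrow> signed_incidence_row n (\<lambda>j. A $$ (i, j))"
  shows "\<bar>det A\<bar> \<le> 1"
  using assms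
proof (induction n arbitrary: A)
  case 0
  then show ?case by simp
next
  case (Suc n)
  note A = Suc.prems(1)
  note vals = Suc.prems(2)[unfolded signed_incidence_row_def]
  show ?case
  proof (cases "\<exists>i<Suc n. \<exists>j<Suc n. \<forall>j'<Suc n. j' \<noteq> j \<longrightarrow> A $$ (i, j') = 0")
    case True
    then obtain i j where ij: "i < Suc n" "j < Suc n"
      and z: "\<And>j'. j' < Suc n \<Longrightarrow> j' \<noteq> j \<Longrightarrow> A $$ (i, j') = 0" by blast
    have "det A = (\<Sum>j'<Suc n. A $$ (i, j') * cofactor A i j')"
      by (rule laplace_expansion_row[OF A ij(1)])
    also have "\<dots> = (\<Sum>j'\<in>{j}. A $$ (i, j') * cofactor A i j')"
      by (rule sum.mono_neutral_right) (use ij z in auto)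
    finally have d: "det A = A $$ (i, j) * cofactor A i j" by simp
    have D: "mat_delete A i j \<in> carrier_mat n n" using mat_delete_carrier[OF A] by simp
    have "signed_incidence_row n (\<lambda>y. mat_delete A i j $$ (x, y))" if x: "x < n" for x
    proof -
      have I: "insert_index i x < Suc n" using x by (simp add: insert_index_def)
      have J: "insert_index j y < Suc n" if "y < n" for y using that by (simp add: insert_index_def)
      have e: "mat_delete A i j $$ (x, y) = A $$ (insert_index i x, insert_index j y)" if "y < n" for y
        using mat_delete_index[OF A ij x that] by simp
      have inj: "insert_index j y = insert_index j y' \<Longrightarrow> y = y'" for y y'
        by (auto simp: insert_index_def split: if_splits)
      show ?thesis unfolding signed_incidence_row_def
      proof (intro conjI allI impI)
        fix y assume y: "y < n"
        show "mat_delete A i j $$ (x, y) \<in> {- 1, 0, 1}"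
          unfolding e[OF y] using vals[OF I] J[OF y] by blast
      next
        fix y y' assume y: "y < n" and y': "y' < n" 
          and eq: "mat_delete A i j $$ (x, y) = mat_delete A i j $$ (x, y') \<and> mat_delete A i j $$ (x, y) \<noteq> 0"
        show "y = y'"
          using eq[unfolded e[OF y] e[OF y']] vals[OF I] J[OF y] J[OF y'] inj by blast
      qed
    qed
    then have "\<bar>det (mat_delete A i j)\<bar> \<le> 1" using Suc.IH[OF D] by blast
    then have c: "\<bar>cofactor A i j\<bar> \<le> 1" by (simp add: cofactor_def abs_mult power_abs)
    have "\<bar>A $$ (i, j)\<bar> \<le> 1" using vals[OF ij(1)] ij(2) by force
    then show ?thesis unfolding d abs_mult using c by (simp add: mult_le_one)
  next
    case False
    have "(\<Sum>j<Suc n. A $$ (i, j)) = 0" if i: "i < Suc n" for i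
    proof (rule signed_incidence_row_sum_zero[OF Suc.prems(2)[OF i]])
      show "\<exists>j'<Suc n. j' \<noteq> j \<and> A $$ (i, j') \<noteq> 0" if "j < Suc n" for j
        using False i that by blast
    qed
    then have "A *\<^sub>v vec (Suc n) (\<lambda>_. 1) = 0\<^sub>v (Suc n)"
      using A by (intro eq_vecI) (auto simp: scalar_prod_def atLeast0LessThan)
    moreover have "vec (Suc n) (\<lambda>_. 1 :: int) \<noteq> 0\<^sub>v (Suc n)"
    proof
      assume "vec (Suc n) (\<lambda>_. 1 :: int) = 0\<^sub>v (Suc n)"
      then have "vec (Suc n) (\<lambda>_. 1 :: int) $ 0 = 0\<^sub>v (Suc n) $ 0" by metis
      then show False by simp
    qed
    ultimately have "det A = 0" 
      unfolding det_0_iff_vec_prod_zero[OF A] by (metis vec_carrier)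
    then show ?thesis by simp
  qed
qed

abbreviation mat_of_fun :: "nat \<Rightarrow> (nat \<Rightarrow> nat \<Rightarrow> int) \<Rightarrow> int mat" where
  "mat_of_fun n w \<equiv> mat n n (\<lambda>(i, j). w i j)"

text \<open>Cofactors along row \<open>i\<close> do not involve that row, so the determinant is
  linear in \<open>f\<close>. This serves to split rows into summands and to read Cramer
  coefficients as determinants.\<close>

lemma det_mat_of_fun_upd:
  assumes "i < n"
  shows "det (mat_of_fun n (w(i := f))) = (\<Sum>j<n. f j * cofactor (mat_of_fun n w) i j)"
proof -
  have "mat_delete (mat_of_fun n (w(i := f))) i j = mat_delete (mat_of_fun n w) i j" for j
    unfolding mat_delete_def by (rule eq_matI) (auto simp: fun_upd_def)
  then have "cofactor (mat_of_fun n (w(i := f))) i j = cofactor (mat_of_fun n w) i j" for j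
    by (simp add: cofactor_def)
  then show ?thesis
    using laplace_expansion_row[of "mat_of_fun n (w(i := f))" n i] assms by simp
qed

lemma abs_det_two_signed_incidence_le:
  assumes "\<And>i. i < n \<Longrightarrow> \<exists>g h. signed_incidence_row n g \<and> signed_incidence_row n h \<and> w i = (\<lambda>j. g j + h j)"
  shows "\<bar>det (mat_of_fun n w)\<bar> \<le> 2 ^ n"
proof -
  \<comment> \<open>Induction on the number of rows still to be split: rows below \<open>m\<close>
    are sums, the others are single signed incidence rows. Each splitting doubles the number of
    determinants.\<close>
  have "\<bar>det (mat_of_fun n w)\<bar> \<le> 2 ^ m" 
    if "m \<le> n" and "\<And>i. i < m \<Longrightarrow> \<exists>g h. signed_incidence_row n g \<and> signed_incidence_row n h \<and> w i = (\<lambda>j. g j + h j)"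
      and "\<And>i. m \<le> i \<Longrightarrow> i < n \<Longrightarrow> signed_incidence_row n (w i)" for m
    using that
  proof (induction m arbitrary: w)
    case 0
    have "\<bar>det (mat_of_fun n w)\<bar> \<le> 1"
      by (rule abs_det_signed_incidence_le_1[of _ n]) (use 0 in \<open>auto simp: signed_incidence_row_def\<close>)
    then show ?case by simp
  next
    case (Suc m)
    obtain g h where gh: "signed_incidence_row n g" "signed_incidence_row n h" "w m = (\<lambda>j. g j + h j)"
      using Suc.prems(2)[of m] by blast
    have m: "m < n" using Suc.prems(1) by simp
    have "det (mat_of_fun n w) = det (mat_of_fun n (w(m := w m)))" by simp
    also have "\<dots> = det (mat_of_fun n (w(m := g))) + det (mat_of_fun n (w(m := h)))"
      unfolding det_mat_of_fun_upd[OF m] gh(3) by (simp add: algebra_simps sum.distrib)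
    finally have d: "det (mat_of_fun n w) = \<dots>" .
    have *: "\<bar>det (mat_of_fun n (w(m := f)))\<bar> \<le> 2 ^ m" if "signed_incidence_row n f" for f
    proof (rule Suc.IH)
      show "m \<le> n" using m by simp
      show "\<exists>g h. signed_incidence_row n g \<and> signed_incidence_row n h \<and> (w(m := f)) i = (\<lambda>j. g j + h j)" if "i < m" for i
        using Suc.prems(2)[of i] that by simp
      show "signed_incidence_row n ((w(m := f)) i)" if "m \<le> i" "i < n" for i
        using Suc.prems(3)[of i] that \<open>signed_incidence_row n f\<close> by (cases "i = m") auto
    qed
    show ?case unfolding d power_Suc using *[OF gh(1)] *[OF gh(2)] by linarith
  qed
  from this[of n] show ?thesis using assms by auto
qed


text \<open>
  Choose an invertible square matrix whose rows are unit rows or members of \<open>F\<close>, with as many members of \<open>F\<close> as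
  possible. Its determinant is prime to \<open>p\<close>, so Cramer's rule produces \<open>x'\<close>; by maximality every other member of \<open>F\<close>
  is a rational combination of the ones chosen.
\<close>

lemma prime_lift_of_two_signed_incidence:
  fixes F :: "(nat \<Rightarrow> int) set" and x :: "nat \<Rightarrow> int" and p :: int
  assumes p: "prime p" "2 ^ k < p"
    and F: "\<And>f. f \<in> F \<Longrightarrow> \<exists>g h. signed_incidence_row k g \<and> signed_incidence_row k h \<and> f = (\<lambda>j. g j + h j)"
    and x: "\<And>f. f \<in> F \<Longrightarrow> p dvd (\<Sum>c<k. f c * x c)"
  obtains x' where "\<And>c. c < k \<Longrightarrow> [x' c = x c] (mod p)"
    and "\<And>f. f \<in> F \<Longrightarrow> (\<Sum>c<k. f c * x' c) = 0"
proof -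
  define u :: "nat \<Rightarrow> nat \<Rightarrow> int" where "u = (\<lambda>c j. if j = c then 1 else 0)"
  define adm where "adm w \<longleftrightarrow> (\<forall>i<k. w i \<in> F \<or> w i = u i) \<and> det (mat_of_fun k w) \<noteq> 0" for w
  define nF where "nF w = card {i. i < k \<and> w i \<in> F}" for w :: "nat \<Rightarrow> nat \<Rightarrow> int"
  have "mat_of_fun k u = 1\<^sub>m k" by (rule eq_matI) (auto simp: u_def)
  then have "adm u" by (simp add: adm_def)
  moreover have "nF w \<le> k" for w
    using card_mono[of "{..<k}" "{i. i < k \<and> w i \<in> F}"] by (auto simp: nF_def)
  ultimately obtain w where w: "adm w" and wmax: "\<And>v. adm v \<Longrightarrow> nF v \<le> nF w"
    using ex_has_greatest_nat[of adm u nF "Suc k"] by (auto simp: less_Suc_eq_le)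
  define W where "W = mat_of_fun k w"
  define D where "D = det W"
  have D0: "D \<noteq> 0" using w by (simp add: adm_def D_def W_def)
  have W: "W \<in> carrier_mat k k" by (simp add: W_def)
  have uinc: "signed_incidence_row k (u i)" for i by (auto simp: signed_incidence_row_def u_def)
  have zinc: "signed_incidence_row k (\<lambda>_. 0)" by (auto simp: signed_incidence_row_def)
  have "\<bar>D\<bar> \<le> 2 ^ k" unfolding D_def W_def
  proof (rule abs_det_two_signed_incidence_le)
    fix i assume "i < k"
    then consider "w i \<in> F" | "w i = u i" using w by (auto simp: adm_def)
    then show "\<exists>g h. signed_incidence_row k g \<and> signed_incidence_row k h \<and> w i = (\<lambda>j. g j + h j)"
    proof cases
      case 1
      then show ?thesis by (rule F)
    next
      case 2
      then show ?thesis by (intro exI[of _ "u i"] exI[of _ "\<lambda>_. 0"]) (simp add: uinc zinc)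
    qed
  qed
  then have "\<not> p dvd D" using D0 p(2) zdvd_imp_le[of p "\<bar>D\<bar>"] by auto
  then have cop: "coprime D p" using p(1) by (metis coprime_commute prime_imp_coprime)
  then obtain D' where D': "[D * D' = 1] (mod p)" using coprime_iff_invertible_int by blast
  define cof where "cof i j = cofactor W i j" for i j
  have E1: "(\<Sum>j<k. w i j * cof i' j) = (if i = i' then D else 0)" if "i < k" "i' < k" for i i'
  proof -
    have "(W * adj_mat W) $$ (i, i') = (D \<cdot>\<^sub>m 1\<^sub>m k) $$ (i, i')"
      using adj_mat(2)[OF W] by (simp add: D_def)
    then show ?thesis
      using that W by (simp add: W_def adj_mat_def scalar_prod_def atLeast0LessThan cof_def)
  qed
  have E2: "(\<Sum>i<k. cof i j * w i j') = (if j = j' then D else 0)" if "j < k" "j' < k" for j j'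
  proof -
    have "(adj_mat W * W) $$ (j, j') = (D \<cdot>\<^sub>m 1\<^sub>m k) $$ (j, j')"
      using adj_mat(3)[OF W] by (simp add: D_def)
    then show ?thesis
      using that W by (simp add: W_def adj_mat_def scalar_prod_def atLeast0LessThan cof_def)
  qed
  define y where "y i = (\<Sum>c<k. w i c * x c)" for i
  \<comment> \<open>The vector \<open>z\<close> solves \<open>D * z = y\<close> modulo
    \<open>p\<close>. On rows from \<open>F\<close> the right side is divisible by \<open>p\<close>,
    and choosing exactly \<open>0\<close> there makes these equations hold over the integers; on
    unit rows any solution modulo \<open>p\<close> will do.\<close>
  define z where "z i = (if w i \<in> F then 0 else D' * y i)" for i
  define x' where "x' c = (\<Sum>i<k. cof i c * z i)" for c
  have Dz: "[D * z i = y i] (mod p)" for i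
  proof (cases "w i \<in> F")
    case True
    then have "[y i = 0] (mod p)" using x[of "w i"] by (simp add: y_def cong_0_iff)
    then show ?thesis using True by (simp add: z_def cong_sym)
  next
    case False
    have "[D * D' * y i = 1 * y i] (mod p)" by (intro cong_mult D' cong_refl)
    then show ?thesis using False by (simp add: z_def mult.assoc)
  qed
  have Wx': "(\<Sum>c<k. w i c * x' c) = D * z i" if "i < k" for i
  proof -
    have "(\<Sum>c<k. w i c * x' c) = (\<Sum>i'<k. (\<Sum>c<k. w i c * cof i' c) * z i')"
      unfolding x'_def sum_distrib_left sum_distrib_right by (subst sum.swap) (simp add: mult.assoc)
    also have "\<dots> = (\<Sum>i'<k. if i = i' then D * z i' else 0)"
      by (rule sum.cong) (use E1 that in auto)
    also have "\<dots> = D * z i" using that by simp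
    finally show ?thesis .
  qed
  show ?thesis
  proof
    fix c assume c: "c < k"
    have "D * x' c = (\<Sum>i<k. cof i c * (D * z i))"
      unfolding x'_def sum_distrib_left by (simp add: algebra_simps)
    moreover have "[(\<Sum>i<k. cof i c * (D * z i)) = (\<Sum>i<k. cof i c * y i)] (mod p)"
      by (intro cong_sum cong_mult cong_refl Dz)
    moreover have "(\<Sum>i<k. cof i c * y i) = (\<Sum>c'<k. (\<Sum>i<k. cof i c * w i c') * x c')"
      unfolding y_def sum_distrib_left sum_distrib_right by (subst sum.swap) (simp add: mult.assoc)
    moreover have "\<dots> = (\<Sum>c'<k. if c = c' then D * x c' else 0)"
      by (rule sum.cong) (use E2 c in auto)
    moreover have "\<dots> = D * x c" using c by simp
    ultimately have "[D * x' c = D * x c] (mod p)" by simp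
    then show "[x' c = x c] (mod p)" using cong_mult_lcancel[OF cop] by simp
  next
    fix f assume f: "f \<in> F"
    \<comment> \<open>\<open>kap i\<close> is the determinant of \<open>W\<close> with row
      \<open>i\<close> replaced by \<open>f\<close>; by Cramer's rule these are the coefficients of
      \<open>D * f\<close> in the rows of \<open>W\<close>. At a row outside \<open>F\<close> a
      nonzero value would give an admissible matrix with one more member of
      \<open>F\<close>.\<close>
    define kap where "kap i = (\<Sum>j<k. f j * cof i j)" for i
    have kz: "kap i * z i = 0" if i: "i < k" for i
    proof (cases "w i \<in> F")
      case False
      have "det (mat_of_fun k (w(i := f))) = 0"
      proof (rule ccontr)
        assume "det (mat_of_fun k (w(i := f))) \<noteq> 0"
        then have "adm (w(i := f))" using w f by (auto simp: adm_def)
        from wmax[OF this] have "nF (w(i := f)) \<le> nF w" .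
        moreover have "{i'. i' < k \<and> (w(i := f)) i' \<in> F} = insert i {i'. i' < k \<and> w i' \<in> F}"
          using i f by auto
        then have "nF (w(i := f)) = Suc (nF w)" using False by (simp add: nF_def)
        ultimately show False by simp
      qed
      then have "kap i = 0" unfolding kap_def cof_def W_def det_mat_of_fun_upd[OF i] .
      then show ?thesis by simp
    qed (simp add: z_def)
    have Df: "D * f j = (\<Sum>i<k. kap i * w i j)" if j: "j < k" for j
    proof -
      have "(\<Sum>i<k. kap i * w i j) = (\<Sum>j'<k. f j' * (\<Sum>i<k. cof i j' * w i j))"
        unfolding kap_def sum_distrib_left sum_distrib_right by (subst sum.swap) (simp add: mult.assoc)
      also have "\<dots> = (\<Sum>j'<k. if j = j' then D * f j' else 0)"
        by (rule sum.cong) (use E2 j in \<open>auto simp: mult.commute\<close>)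
      also have "\<dots> = D * f j" using j by simp
      finally show ?thesis by simp
    qed
    have "D * (\<Sum>c<k. f c * x' c) = (\<Sum>c<k. (\<Sum>i<k. kap i * w i c) * x' c)"
      unfolding sum_distrib_left by (rule sum.cong) (simp_all add: Df mult.assoc[symmetric])
    also have "\<dots> = (\<Sum>i<k. kap i * (\<Sum>c<k. w i c * x' c))"
      unfolding sum_distrib_left sum_distrib_right by (subst sum.swap) (simp add: mult.assoc)
    also have "\<dots> = (\<Sum>i<k. D * (kap i * z i))" by (rule sum.cong) (simp_all add: Wx')
    also have "\<dots> = 0" by (rule sum.neutral) (use kz in auto)
    finally show "(\<Sum>c<k. f c * x' c) = 0" using D0 by simp
  qed
qed

section \<open>Homometric sequences modulo a prime\<close>

text \<open>This is unique factorisation over the field with \<open>p\<close> elements, phrased as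
  divisibility by the constant \<open>[:p:]\<close>. Evaluation at a root \<open>x i\<close> makes
  \<open>p\<close> divide some \<open>x i - y j\<close>; both linear factors are then removed, since
  \<open>[:p:]\<close> is a prime element that does not divide a monic polynomial.\<close>

lemma prime_dvd_prod_linear_diff_imp_bij:
  fixes p :: int and x :: "'i \<Rightarrow> int" and y :: "'j \<Rightarrow> int"
  assumes p: "prime p" and "finite I" "finite J" "card I = card J"
    and "[:p:] dvd (\<Prod>i\<in>I. [:- x i, 1:]) - (\<Prod>j\<in>J. [:- y j, 1:])"
  shows "\<exists>\<pi>. bij_betw \<pi> I J \<and> (\<forall>i\<in>I. [x i = y (\<pi> i)] (mod p))"
  using assms(2-)
proof (induction I arbitrary: J rule: finite_induct)
  case empty
  then show ?case by (auto simp: bij_betw_def)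
next
  case (insert i I)
  let ?P = "\<Prod>i\<in>I. [:- x i, 1:]"
  have pp: "prime_elem [:p:]" using p unfolding prime_elem_const_poly_iff by (rule prime_imp_prime_elem)
  obtain r where r: "(\<Prod>i\<in>insert i I. [:- x i, 1:]) - (\<Prod>j\<in>J. [:- y j, 1:]) = [:p:] * r"
    using insert.prems by (auto elim: dvdE)
  have "poly ((\<Prod>i\<in>insert i I. [:- x i, 1:]) - (\<Prod>j\<in>J. [:- y j, 1:])) (x i) = p * poly r (x i)"
    unfolding r by simp
  then have "(\<Prod>j\<in>J. x i - y j) = p * - poly r (x i)"
    using insert.hyps by (simp add: poly_prod)
  then have "p dvd (\<Prod>j\<in>J. x i - y j)" by simp
  then obtain j where j: "j \<in> J" "p dvd x i - y j"
    using p insert.prems(1) by (auto simp: prime_dvd_prod_iff)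
  let ?Q = "\<Prod>j\<in>J - {j}. [:- y j, 1:]"
  have "[:p:] dvd [:x i - y j:]" using j(2) by (simp add: const_poly_dvd_iff coeff_pCons split: nat.split)
  then have d1: "[:p:] dvd [:x i - y j:] * ?Q" by (rule dvd_mult2)
  have "(\<Prod>j\<in>J. [:- y j, 1:]) = [:- y j, 1:] * ?Q"
    using insert.prems(1) j(1) by (simp add: prod.remove)
  also have "[:- y j, 1:] = [:- x i, 1:] + [:x i - y j:]" by simp
  finally have Q: "(\<Prod>j\<in>J. [:- y j, 1:]) = [:- x i, 1:] * ?Q + [:x i - y j:] * ?Q"
    by (simp only: distrib_right)
  have "[:p:] dvd [:- x i, 1:] * (?P - ?Q) - [:x i - y j:] * ?Q"
    using insert.prems(3) insert.hyps unfolding Q by (simp add: algebra_simps)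
  then have "[:p:] dvd [:- x i, 1:] * (?P - ?Q)" using d1 by (metis diff_add_cancel dvd_add)
  moreover have "\<not> [:p:] dvd [:- x i, 1:]"
  proof
    assume "[:p:] dvd [:- x i, 1:]"
    then have "p dvd coeff [:- x i, 1:] 1" using const_poly_dvd_iff by blast
    then show False using p by (simp add: not_prime_unit)
  qed
  ultimately have "[:p:] dvd ?P - ?Q" using pp prime_elem_dvd_multD by blast
  moreover have "card I = card (J - {j})" using insert j by (simp add: card_Diff_singleton)
  ultimately obtain \<pi> where \<pi>: "bij_betw \<pi> I (J - {j})" "\<forall>i\<in>I. [x i = y (\<pi> i)] (mod p)"
    using insert.IH[of "J - {j}"] insert.prems(1) by auto
  have "bij_betw (\<pi>(i := j)) I (J - {j})"
    using \<pi>(1) insert.hyps(2) by (subst bij_betw_cong[of _ _ \<pi>]) auto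
  then have "bij_betw (\<pi>(i := j)) (I \<union> {i}) ((J - {j}) \<union> {j})"
    using insert.hyps(2) by (intro bij_betw_combine) (auto simp: bij_betw_def)
  moreover have "I \<union> {i} = insert i I" "(J - {j}) \<union> {j} = J" using j by auto
  ultimately have "bij_betw (\<pi>(i := j)) (insert i I) J" by simp
  moreover have "\<forall>l\<in>insert i I. [x l = y ((\<pi>(i := j)) l)] (mod p)"
    using \<pi>(2) insert.hyps(2) j(2) by (auto simp: cong_iff_dvd_diff)
  ultimately show ?case by blast
qed

text \<open>Every variable is a root of the quintic, which gives a linear recurrence for the power
  sums. Four terms are covered by \<open>e = 0\<close>, whence the explicit formula for
  \<open>e5\<close>. The exponents are those that survive in even powers of differences up to the
  tenth; the ninth power sum would be multiplied by the first, which is \<open>0\<close>.\<close>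

lemma newton_identities_five:
  fixes a b c d e :: int
  assumes "a + b + c + d + e = 0"
  obtains e2 e3 e4 e5 where
    "\<And>t. (t - a) * (t - b) * (t - c) * (t - d) * (t - e) = t^5 + e2 * t^3 - e3 * t^2 + e4 * t - e5"
    "e5 = a * b * c * d * e"
    "a^2 + b^2 + c^2 + d^2 + e^2 = - 2 * e2"
    "a^3 + b^3 + c^3 + d^3 + e^3 = 3 * e3"
    "a^4 + b^4 + c^4 + d^4 + e^4 = 2 * e2^2 - 4 * e4"
    "a^5 + b^5 + c^5 + d^5 + e^5 = 5 * e5 - 5 * (e2 * e3)"
    "a^6 + b^6 + c^6 + d^6 + e^6 = - 2 * e2^3 + 6 * (e2 * e4) + 3 * e3^2"
    "a^7 + b^7 + c^7 + d^7 + e^7 = 7 * (e2^2 * e3) - 7 * (e2 * e5) - 7 * (e3 * e4)"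
    "a^8 + b^8 + c^8 + d^8 + e^8 = 2 * e2^4 - 8 * (e2^2 * e4) - 8 * (e2 * e3^2) + 8 * (e3 * e5) + 4 * e4^2"
    "a^10 + b^10 + c^10 + d^10 + e^10 = - 2 * e2^5 + 10 * (e2^3 * e4) + 15 * (e2^2 * e3^2) - 20 * (e2 * e3 * e5)
       - 10 * (e2 * e4^2) - 10 * (e3^2 * e4) + 5 * e5^2"
proof -
  define P where "P m = a^m + b^m + c^m + d^m + e^m" for m :: nat
  define e2 where "e2 = a*b + a*c + a*d + a*e + b*c + b*d + b*e + c*d + c*e + d*e"
  define e3 where "e3 = a*b*c + a*b*d + a*b*e + a*c*d + a*c*e + a*d*e + b*c*d + b*c*e + b*d*e + c*d*e"
  define e4 where "e4 = a*b*c*d + a*b*c*e + a*b*d*e + a*c*d*e + b*c*d*e"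
  define e5 where "e5 = a*b*c*d*e"
  have "(t - a) * (t - b) * (t - c) * (t - d) * (t - e)
      = t^5 - (a + b + c + d + e) * t^4 + e2 * t^3 - e3 * t^2 + e4 * t - e5" for t
    unfolding e2_def e3_def e4_def e5_def by Groebner_Basis.algebra
  then have fac: "(t - a) * (t - b) * (t - c) * (t - d) * (t - e) = t^5 + e2 * t^3 - e3 * t^2 + e4 * t - e5" for t
    using assms by simp
  have root: "t^(m+5) = - e2 * t^(m+3) + e3 * t^(m+2) - e4 * t^(m+1) + e5 * t^m" 
    if "t \<in> {a, b, c, d, e}" for t and m :: nat
  proof -
    have "(t - a) * (t - b) * (t - c) * (t - d) * (t - e) = 0" using that by auto
    then have "t^5 + e2 * t^3 - e3 * t^2 + e4 * t - e5 = 0" using fac by simp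
    then have "t^m * (t^5 + e2 * t^3 - e3 * t^2 + e4 * t - e5) = 0" by simp
    then show ?thesis by (simp add: power_add algebra_simps power2_eq_square)
  qed
  have rec: "P (m+5) = - e2 * P (m+3) + e3 * P (m+2) - e4 * P (m+1) + e5 * P m" for m
    unfolding P_def using root[of a m] root[of b m] root[of c m] root[of d m] root[of e m]
    by (simp add: algebra_simps)
  \<comment> \<open>Eliminating one variable turns the base cases \<open>P2\<close> to
    \<open>P4\<close> into unconditional polynomial identities.\<close>
  have e: "e = - (a + b + c + d)" using assms by simp
  have P0: "P 0 = 5" and P1: "P 1 = 0" using assms by (simp_all add: P_def)
  have P2: "P 2 = - 2 * e2" unfolding P_def e2_def e by Groebner_Basis.algebra
  have P3: "P 3 = 3 * e3" unfolding P_def e3_def e by Groebner_Basis.algebra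
  have P4: "P 4 = 2 * e2^2 - 4 * e4" unfolding P_def e2_def e4_def e by Groebner_Basis.algebra
  have "P 5 = - e2 * P 3 + e3 * P 2 - e4 * P 1 + e5 * P 0"
    using rec[of 0] by (simp add: numeral_eq_Suc)
  then have P5: "P 5 = 5 * e5 - 5 * (e2 * e3)" unfolding P0 P1 P2 P3 by simp
  have "P 6 = - e2 * P 4 + e3 * P 3 - e4 * P 2 + e5 * P 1"
    using rec[of 1] by (simp add: numeral_eq_Suc)
  then have P6: "P 6 = - 2 * e2^3 + 6 * (e2 * e4) + 3 * e3^2" unfolding P1 P2 P3 P4 by Groebner_Basis.algebra
  have "P 7 = - e2 * P 5 + e3 * P 4 - e4 * P 3 + e5 * P 2"
    using rec[of 2] by (simp add: numeral_eq_Suc)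
  then have P7: "P 7 = 7 * (e2^2 * e3) - 7 * (e2 * e5) - 7 * (e3 * e4)" 
    unfolding P2 P3 P4 P5 by Groebner_Basis.algebra
  have "P 8 = - e2 * P 6 + e3 * P 5 - e4 * P 4 + e5 * P 3"
    using rec[of 3] by (simp add: numeral_eq_Suc)
  then have P8: "P 8 = 2 * e2^4 - 8 * (e2^2 * e4) - 8 * (e2 * e3^2) + 8 * (e3 * e5) + 4 * e4^2"
    unfolding P3 P4 P5 P6 by Groebner_Basis.algebra
  have "P 10 = - e2 * P 8 + e3 * P 7 - e4 * P 6 + e5 * P 5"
    using rec[of 5] by (simp add: numeral_eq_Suc)
  then have P10: "P 10 = - 2 * e2^5 + 10 * (e2^3 * e4) + 15 * (e2^2 * e3^2) - 20 * (e2 * e3 * e5)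
       - 10 * (e2 * e4^2) - 10 * (e3^2 * e4) + 5 * e5^2"
    unfolding P5 P6 P7 P8 by Groebner_Basis.algebra
  show ?thesis
    by (rule that[of e2 e3 e4 e5]) (use fac e5_def P2 P3 P4 P5 P6 P7 P8 P10 in \<open>auto simp: P_def\<close>)
qed

text \<open>Binomial expansion gives products of power sums with complementary exponents. Mirror
  terms combine, so every coefficient but the middle one is twice a signed binomial coefficient, and
  \<open>P 1 = 0\<close> removes one pair. Odd exponents carry no information, as their sums cancel
  by antisymmetry.\<close>

lemma sum_sum_diff_power:
  fixes x :: "nat \<Rightarrow> int" and k :: nat
  defines "P \<equiv> \<lambda>m. \<Sum>i<k. x i ^ m"
  assumes "P 1 = 0"
  shows "(\<Sum>i<k. \<Sum>j<k. (x i - x j)^2) = 2 * int k * P 2"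
    and "(\<Sum>i<k. \<Sum>j<k. (x i - x j)^4) = 2 * int k * P 4 + 6 * (P 2)^2"
    and "(\<Sum>i<k. \<Sum>j<k. (x i - x j)^6) = 2 * int k * P 6 + 30 * P 2 * P 4 - 20 * (P 3)^2"
    and "(\<Sum>i<k. \<Sum>j<k. (x i - x j)^8) = 2 * int k * P 8 + 56 * P 2 * P 6 - 112 * P 3 * P 5 + 70 * (P 4)^2"
    and "(\<Sum>i<k. \<Sum>j<k. (x i - x j)^10) = 2 * int k * P 10 + 90 * P 2 * P 8 - 240 * P 3 * P 7
           + 420 * P 4 * P 6 - 252 * (P 5)^2"
proof -
  have PP: "(\<Sum>i<k. \<Sum>j<k. c * x i ^ s * x j ^ t) = c * P s * P t" for c s t
  proof -
    have "c * P s * P t = (\<Sum>i<k. c * x i ^ s) * P t" by (simp add: P_def sum_distrib_left)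
    then show ?thesis by (simp add: P_def sum_product)
  qed
  have P0: "P 0 = int k" by (simp add: P_def)
  note S = sum.distrib sum_subtractf PP P0 assms(2)
  have "(u - v)^2 = 1 * u^2 * v^0 + (-2) * u^1 * v^1 + 1 * u^0 * v^2" for u v :: int
    by Groebner_Basis.algebra
  then show "(\<Sum>i<k. \<Sum>j<k. (x i - x j)^2) = 2 * int k * P 2" by (simp only: S) simp
  have "(u - v)^4 = 1 * u^4 * v^0 + (-4) * u^3 * v^1 + 6 * u^2 * v^2 + (-4) * u^1 * v^3 + 1 * u^0 * v^4" for u v :: int
    by Groebner_Basis.algebra
  then show "(\<Sum>i<k. \<Sum>j<k. (x i - x j)^4) = 2 * int k * P 4 + 6 * (P 2)^2"
    by (simp only: S) (simp add: power2_eq_square)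
  have "(u - v)^6 = 1 * u^6 * v^0 + (-6) * u^5 * v^1 + 15 * u^4 * v^2 + (-20) * u^3 * v^3 + 15 * u^2 * v^4
      + (-6) * u^1 * v^5 + 1 * u^0 * v^6" for u v :: int
    by Groebner_Basis.algebra
  then show "(\<Sum>i<k. \<Sum>j<k. (x i - x j)^6) = 2 * int k * P 6 + 30 * P 2 * P 4 - 20 * (P 3)^2"
    by (simp only: S) (simp add: power2_eq_square)
  have "(u - v)^8 = 1 * u^8 * v^0 + (-8) * u^7 * v^1 + 28 * u^6 * v^2 + (-56) * u^5 * v^3 + 70 * u^4 * v^4
      + (-56) * u^3 * v^5 + 28 * u^2 * v^6 + (-8) * u^1 * v^7 + 1 * u^0 * v^8" for u v :: int
    by Groebner_Basis.algebra
  then show "(\<Sum>i<k. \<Sum>j<k. (x i - x j)^8) = 2 * int k * P 8 + 56 * P 2 * P 6 - 112 * P 3 * P 5 + 70 * (P 4)^2"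
    by (simp only: S) (simp add: power2_eq_square)
  have "(u - v)^10 = 1 * u^10 * v^0 + (-10) * u^9 * v^1 + 45 * u^8 * v^2 + (-120) * u^7 * v^3 + 210 * u^6 * v^4
      + (-252) * u^5 * v^5 + 210 * u^4 * v^6 + (-120) * u^3 * v^7 + 45 * u^2 * v^8 + (-10) * u^1 * v^9
      + 1 * u^0 * v^10" for u v :: int
    by Groebner_Basis.algebra
  then show "(\<Sum>i<k. \<Sum>j<k. (x i - x j)^10) = 2 * int k * P 10 + 90 * P 2 * P 8 - 240 * P 3 * P 7
           + 420 * P 4 * P 6 - 252 * (P 5)^2"
    by (simp only: S) (simp add: power2_eq_square)
qed

text \<open>In use, \<open>u\<close> is the symmetric function to be determined, entering with a
  constant coefficient \<open>c\<close>, and \<open>w\<close> collects the terms in functions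
  already matched.\<close>

lemma prime_cong_mult_const_cancel:
  fixes p c u v w :: int
  assumes "prime p" "\<not> p dvd c" "[c * u + w = c * v + w'] (mod p)" "[w = w'] (mod p)"
  shows "[u = v] (mod p)"
proof -
  have "p dvd (c * u + w - (c * v + w')) - (w - w')"
    using dvd_diff assms(3,4) unfolding cong_iff_dvd_diff by blast
  then have "p dvd c * (u - v)" by (simp add: algebra_simps)
  then show ?thesis using assms(1,2) by (simp add: prime_dvd_mult_iff cong_iff_dvd_diff)
qed

text \<open>
  The leading constants with which \<open>e\<^sub>2\<close>, \<open>e\<^sub>4\<close>, \<open>e\<^sub>3\<^sup>2\<close> (for four terms) and \<open>e\<^sub>2\<close>, \<open>e\<^sub>4\<close>, \<open>e\<^sub>3\<^sup>2\<close>, \<open>e\<^sub>3 e\<^sub>5\<close>, \<open>e\<^sub>5\<^sup>2\<close>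
  (for five terms) enter the power sums of the differences.
\<close>

lemma prime_not_dvd_const:
  fixes p :: int
  assumes "prime p" "p > 13"
  shows "\<not> p dvd 16" "\<not> p dvd 32" "\<not> p dvd 156" "\<not> p dvd 20" "\<not> p dvd 40" "\<not> p dvd 150"
    "\<not> p dvd 1600" "\<not> p dvd 6250"
proof -
  have small: "\<not> p dvd q" if "q \<in> {2, 3, 5, 13}" for q
    using that assms(2) zdvd_imp_le[of p q] by auto
  have "(16::int) = 2^4" "(32::int) = 2^5" "(156::int) = 2^2 * (3 * 13)" "(20::int) = 2^2 * 5" 
    "(40::int) = 2^3 * 5" "(150::int) = 2 * (3 * 5^2)" "(1600::int) = 2^6 * 5^2" "(6250::int) = 2 * 5^5"
    by simp_all
  then show "\<not> p dvd 16" "\<not> p dvd 32" "\<not> p dvd 156" "\<not> p dvd 20" "\<not> p dvd 40" "\<not> p dvd 150"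
    "\<not> p dvd 1600" "\<not> p dvd 6250"
    using small assms(1) by (metis insertI1 insertI2 prime_dvd_mult_iff prime_dvd_power)+
qed

text \<open>The squares alone leave two independent signs; the product couples them. If
  \<open>p\<close> divides \<open>u\<close>, both signs suit \<open>u\<close>, and the one that
  suits \<open>v\<close> is taken.\<close>

lemma prime_cong_square_imp_sign:
  fixes p u v u' v' :: int
  assumes p: "prime p" and "[u^2 = u'^2] (mod p)" "[u * v = u' * v'] (mod p)" "[v^2 = v'^2] (mod p)"
  shows "\<exists>s\<in>{1, -1}. [u = s * u'] (mod p) \<and> [v = s * v'] (mod p)"
proof -
  have sq: "p dvd w - w' \<or> p dvd w + w'" if "[w^2 = w'^2] (mod p)" for w w'
  proof -
    have "w^2 - w'^2 = (w - w') * (w + w')" by Groebner_Basis.algebra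
    then show ?thesis using that p by (simp add: cong_iff_dvd_diff prime_dvd_mult_iff)
  qed
  show ?thesis
  proof (cases "p dvd u")
    case True
    then have "p dvd u'"
      using assms(2) p by (metis cong_dvd_iff prime_dvd_power dvd_power zero_less_numeral dvd_trans)
    then show ?thesis using True sq[OF assms(4)] by (auto simp: cong_iff_dvd_diff)
  next
    case False
    have "\<exists>s\<in>{1, -1}. [u = s * u'] (mod p)" using sq[OF assms(2)] by (auto simp: cong_iff_dvd_diff)
    then obtain s where s: "s \<in> {1, -1}" "[u = s * u'] (mod p)" by blast
    have ss: "s * s = 1" using s by auto
    have "[u * (s * v') = (s * u') * (s * v')] (mod p)" by (intro cong_mult s cong_refl)
    also have "(s * u') * (s * v') = u' * v' * (s * s)" by (simp add: ac_simps)
    also have "[u' * v' * (s * s) = u * v] (mod p)" using assms(3) ss by (simp add: cong_sym)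
    finally have "[u * v = u * (s * v')] (mod p)" by (rule cong_sym)
    then have "p dvd u * (v - s * v')" by (simp add: cong_iff_dvd_diff algebra_simps)
    then have "[v = s * v'] (mod p)" using False p by (simp add: cong_iff_dvd_diff prime_dvd_mult_iff)
    then show ?thesis using s by blast
  qed
qed

text \<open>Four terms are treated as roots of a quintic whose fifth root is \<open>0\<close>. That
  root adds nothing to the power sums, while the factor \<open>int 4\<close> in the sums of
  differences still counts four terms.\<close>

lemma homometric_four_mod_prime:
  fixes x y :: "nat \<Rightarrow> int" and p :: int
  assumes p: "prime p" "p > 13" and x: "(\<Sum>i<4. x i) = 0" and y: "(\<Sum>i<4. y i) = 0"
    and D: "\<And>m. [(\<Sum>i<4. \<Sum>j<4. (x i - x j)^m) = (\<Sum>i<4. \<Sum>j<4. (y i - y j)^m)] (mod p)"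
  shows "\<exists>s\<in>{1, -1}. [:p:] dvd (\<Prod>i<4. [:- x i, 1:]) - (\<Prod>i<4. [:- (s * y i), 1:])"
proof -
  have S4: "(\<Sum>i<4. f i) = f 0 + f 1 + f 2 + f 3" for f :: "nat \<Rightarrow> int" 
    by (simp add: numeral_eq_Suc)
  have Pr4: "(\<Prod>i<4. f i) = f 0 * f 1 * f 2 * f 3" for f :: "nat \<Rightarrow> int poly" 
    by (simp add: numeral_eq_Suc)
  obtain e2 e3 e4 e5 where 
    ex: "\<And>t. (t - x 0) * (t - x 1) * (t - x 2) * (t - x 3) * (t - 0) = t^5 + e2 * t^3 - e3 * t^2 + e4 * t - e5"
    and ex5: "e5 = x 0 * x 1 * x 2 * x 3 * 0"
    and ep: "x 0^2 + x 1^2 + x 2^2 + x 3^2 + 0^2 = - 2 * e2"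
      "x 0^3 + x 1^3 + x 2^3 + x 3^3 + 0^3 = 3 * e3"
      "x 0^4 + x 1^4 + x 2^4 + x 3^4 + 0^4 = 2 * e2^2 - 4 * e4"
      "x 0^6 + x 1^6 + x 2^6 + x 3^6 + 0^6 = - 2 * e2^3 + 6 * (e2 * e4) + 3 * e3^2"
    by (rule newton_identities_five[of "x 0" "x 1" "x 2" "x 3" 0]) (use x S4 in auto)
  obtain f2 f3 f4 f5 where 
    fy: "\<And>t. (t - y 0) * (t - y 1) * (t - y 2) * (t - y 3) * (t - 0) = t^5 + f2 * t^3 - f3 * t^2 + f4 * t - f5"
    and fy5: "f5 = y 0 * y 1 * y 2 * y 3 * 0"
    and fp: "y 0^2 + y 1^2 + y 2^2 + y 3^2 + 0^2 = - 2 * f2"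
      "y 0^3 + y 1^3 + y 2^3 + y 3^3 + 0^3 = 3 * f3"
      "y 0^4 + y 1^4 + y 2^4 + y 3^4 + 0^4 = 2 * f2^2 - 4 * f4"
      "y 0^6 + y 1^6 + y 2^6 + y 3^6 + 0^6 = - 2 * f2^3 + 6 * (f2 * f4) + 3 * f3^2"
    by (rule newton_identities_five[of "y 0" "y 1" "y 2" "y 3" 0]) (use y S4 in auto)
  have xs: "(\<Sum>i<4. x i ^ 1) = 0" and ys: "(\<Sum>i<4. y i ^ 1) = 0" using x y by simp_all
  \<comment> \<open>Coefficients of the new unknown in degrees 2, 4 and 6: \<open>8 * (-2)\<close>,
    \<open>8 * (-4)\<close> and \<open>8 * 3 - 20 * 9\<close>.\<close>
  have nd: "\<not> p dvd -16" "\<not> p dvd -32" "\<not> p dvd -156" using prime_not_dvd_const[OF p] by auto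
  have px: "(\<Sum>i<4. x i ^ 2) = - 2 * e2" "(\<Sum>i<4. x i ^ 3) = 3 * e3"
    "(\<Sum>i<4. x i ^ 4) = 2 * e2^2 - 4 * e4"
    "(\<Sum>i<4. x i ^ 6) = - 2 * e2^3 + 6 * (e2 * e4) + 3 * e3^2"
    using ep by (simp_all add: S4)
  have py: "(\<Sum>i<4. y i ^ 2) = - 2 * f2" "(\<Sum>i<4. y i ^ 3) = 3 * f3"
    "(\<Sum>i<4. y i ^ 4) = 2 * f2^2 - 4 * f4"
    "(\<Sum>i<4. y i ^ 6) = - 2 * f2^3 + 6 * (f2 * f4) + 3 * f3^2"
    using fp by (simp_all add: S4)
  note expand = sum_sum_diff_power[OF xs] sum_sum_diff_power[OF ys]
  have c2: "[e2 = f2] (mod p)"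
  proof (rule prime_cong_mult_const_cancel[OF p(1) nd(1)])
    show "[-16 * e2 + 0 = -16 * f2 + 0] (mod p)"
      using D[of 2] unfolding expand px py by simp
  qed simp
  have c4: "[e4 = f4] (mod p)"
  proof (rule prime_cong_mult_const_cancel[OF p(1) nd(2)])
    have "2 * int 4 * (2 * e^2 - 4 * f) + 6 * (- 2 * e)^2 = -32 * f + 40 * e^2" for e f
      by (simp add: power2_eq_square)
    then show "[-32 * e4 + 40 * e2^2 = -32 * f4 + 40 * f2^2] (mod p)"
      using D[of 4] unfolding expand px py by simp
    show "[40 * e2^2 = 40 * f2^2] (mod p)" by (intro cong_mult cong_pow cong_refl c2)
  qed
  have c6: "[e3^2 = f3^2] (mod p)"
  proof (rule prime_cong_mult_const_cancel[OF p(1) nd(3)])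
    have e: "2 * int 4 * (- 2 * e^3 + 6 * (e * f) + 3 * a^2) + 30 * (- 2 * e) * (2 * e^2 - 4 * f) - 20 * (3 * a)^2
        = -156 * a^2 + (8 * (- 2 * e^3 + 6 * (e * f)) + 30 * (- 2 * e) * (2 * e^2 - 4 * f))" for e f a
      by (simp add: algebra_simps power2_eq_square)
    show "[-156 * e3^2 + (8 * (- 2 * e2^3 + 6 * (e2 * e4)) + 30 * (- 2 * e2) * (2 * e2^2 - 4 * e4))
        = -156 * f3^2 + (8 * (- 2 * f2^3 + 6 * (f2 * f4)) + 30 * (- 2 * f2) * (2 * f2^2 - 4 * f4))] (mod p)"
      using D[of 6] unfolding expand px py e .
    show "[8 * (- 2 * e2^3 + 6 * (e2 * e4)) + 30 * (- 2 * e2) * (2 * e2^2 - 4 * e4)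
        = 8 * (- 2 * f2^3 + 6 * (f2 * f4)) + 30 * (- 2 * f2) * (2 * f2^2 - 4 * f4)] (mod p)"
      by (intro cong_add cong_diff cong_mult cong_pow cong_refl c2 c4)
  qed
  \<comment> \<open>Only one odd symmetric function is left, so the second pair is filled with
    zeros.\<close>
  obtain s where s: "s \<in> {1, -1}" "[e3 = s * f3] (mod p)"
    using prime_cong_square_imp_sign[OF p(1) c6, of 0 0] by fastforce
  have "[:0, 1:] * (\<Prod>i<4. [:- x i, 1:]) = [:0, 1:] * [:e4, -e3, e2, 0, 1:]"
    by (rule poly_eq_poly_eq_iff[THEN iffD1], rule ext, unfold Pr4)
       (use ex ex5 in \<open>simp add: algebra_simps numeral_eq_Suc\<close>)
  then have X: "(\<Prod>i<4. [:- x i, 1:]) = [:e4, -e3, e2, 0, 1:]" by simp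
  have "[:0, 1:] * (\<Prod>i<4. [:- (s * y i), 1:]) = [:0, 1:] * [:f4, - (s * f3), f2, 0, 1:]"
  proof (rule poly_eq_poly_eq_iff[THEN iffD1], rule ext)
    fix t
    \<comment> \<open>Evaluation at \<open>s * t\<close> with \<open>s * s = 1\<close> yields, up to
      sign, the polynomial with roots \<open>s * y i\<close>, in which only the odd symmetric
      function changes sign.\<close>
    have "(s * t - y 0) * (s * t - y 1) * (s * t - y 2) * (s * t - y 3) * (s * t) 
        = (s * t)^5 + f2 * (s * t)^3 - f3 * (s * t)^2 + f4 * (s * t)" using fy[of "s * t"] fy5 by simp
    then show "poly ([:0, 1:] * (\<Prod>i<4. [:- (s * y i), 1:])) t = poly ([:0, 1:] * [:f4, - (s * f3), f2, 0, 1:]) t"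
      unfolding Pr4 using s(1) by (auto simp: algebra_simps numeral_eq_Suc)
  qed
  then have Y: "(\<Prod>i<4. [:- (s * y i), 1:]) = [:f4, - (s * f3), f2, 0, 1:]" by simp
  have "[:p:] dvd (\<Prod>i<4. [:- x i, 1:]) - (\<Prod>i<4. [:- (s * y i), 1:])"
    unfolding X Y using c2 c4 s(2)
    by (auto simp: const_poly_dvd_iff coeff_pCons cong_iff_dvd_diff dvd_diff_commute split: nat.split)
  then show ?thesis using s(1) by blast
qed

text \<open>The sixth powers give \<open>e3\<close> up to sign and the tenth give \<open>e5\<close>
  up to sign; the mixed product \<open>e3 * e5\<close> from the eighth powers ties the two signs
  together.\<close>

lemma homometric_five_mod_prime:
  fixes x y :: "nat \<Rightarrow> int" and p :: int
  assumes p: "prime p" "p > 13" and x: "(\<Sum>i<5. x i) = 0" and y: "(\<Sum>i<5. y i) = 0"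
    and D: "\<And>m. [(\<Sum>i<5. \<Sum>j<5. (x i - x j)^m) = (\<Sum>i<5. \<Sum>j<5. (y i - y j)^m)] (mod p)"
  shows "\<exists>s\<in>{1, -1}. [:p:] dvd (\<Prod>i<5. [:- x i, 1:]) - (\<Prod>i<5. [:- (s * y i), 1:])"
proof -
  have S5: "(\<Sum>i<5. f i) = f 0 + f 1 + f 2 + f 3 + f 4" for f :: "nat \<Rightarrow> int" 
    by (simp add: numeral_eq_Suc)
  have Pr5: "(\<Prod>i<5. f i) = f 0 * f 1 * f 2 * f 3 * f 4" for f :: "nat \<Rightarrow> int poly" 
    by (simp add: numeral_eq_Suc)
  obtain e2 e3 e4 e5 where 
    ex: "\<And>t. (t - x 0) * (t - x 1) * (t - x 2) * (t - x 3) * (t - x 4) = t^5 + e2 * t^3 - e3 * t^2 + e4 * t - e5"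
    and ep: "x 0^2 + x 1^2 + x 2^2 + x 3^2 + x 4^2 = - 2 * e2"
      "x 0^3 + x 1^3 + x 2^3 + x 3^3 + x 4^3 = 3 * e3"
      "x 0^4 + x 1^4 + x 2^4 + x 3^4 + x 4^4 = 2 * e2^2 - 4 * e4"
      "x 0^5 + x 1^5 + x 2^5 + x 3^5 + x 4^5 = 5 * e5 - 5 * (e2 * e3)"
      "x 0^6 + x 1^6 + x 2^6 + x 3^6 + x 4^6 = - 2 * e2^3 + 6 * (e2 * e4) + 3 * e3^2"
      "x 0^7 + x 1^7 + x 2^7 + x 3^7 + x 4^7 = 7 * (e2^2 * e3) - 7 * (e2 * e5) - 7 * (e3 * e4)"
      "x 0^8 + x 1^8 + x 2^8 + x 3^8 + x 4^8
        = 2 * e2^4 - 8 * (e2^2 * e4) - 8 * (e2 * e3^2) + 8 * (e3 * e5) + 4 * e4^2"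
      "x 0^10 + x 1^10 + x 2^10 + x 3^10 + x 4^10
        = - 2 * e2^5 + 10 * (e2^3 * e4) + 15 * (e2^2 * e3^2) - 20 * (e2 * e3 * e5)
       - 10 * (e2 * e4^2) - 10 * (e3^2 * e4) + 5 * e5^2"
    by (rule newton_identities_five[of "x 0" "x 1" "x 2" "x 3" "x 4"]) (use x S5 in auto)
  obtain f2 f3 f4 f5 where 
    fy: "\<And>t. (t - y 0) * (t - y 1) * (t - y 2) * (t - y 3) * (t - y 4) = t^5 + f2 * t^3 - f3 * t^2 + f4 * t - f5"
    and fp: "y 0^2 + y 1^2 + y 2^2 + y 3^2 + y 4^2 = - 2 * f2"
      "y 0^3 + y 1^3 + y 2^3 + y 3^3 + y 4^3 = 3 * f3"
      "y 0^4 + y 1^4 + y 2^4 + y 3^4 + y 4^4 = 2 * f2^2 - 4 * f4"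
      "y 0^5 + y 1^5 + y 2^5 + y 3^5 + y 4^5 = 5 * f5 - 5 * (f2 * f3)"
      "y 0^6 + y 1^6 + y 2^6 + y 3^6 + y 4^6 = - 2 * f2^3 + 6 * (f2 * f4) + 3 * f3^2"
      "y 0^7 + y 1^7 + y 2^7 + y 3^7 + y 4^7 = 7 * (f2^2 * f3) - 7 * (f2 * f5) - 7 * (f3 * f4)"
      "y 0^8 + y 1^8 + y 2^8 + y 3^8 + y 4^8
        = 2 * f2^4 - 8 * (f2^2 * f4) - 8 * (f2 * f3^2) + 8 * (f3 * f5) + 4 * f4^2"
      "y 0^10 + y 1^10 + y 2^10 + y 3^10 + y 4^10
        = - 2 * f2^5 + 10 * (f2^3 * f4) + 15 * (f2^2 * f3^2) - 20 * (f2 * f3 * f5)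
       - 10 * (f2 * f4^2) - 10 * (f3^2 * f4) + 5 * f5^2"
    by (rule newton_identities_five[of "y 0" "y 1" "y 2" "y 3" "y 4"]) (use y S5 in auto)
  have xs: "(\<Sum>i<5. x i ^ 1) = 0" and ys: "(\<Sum>i<5. y i ^ 1) = 0" using x y by simp_all
  \<comment> \<open>Coefficients of the new unknowns in degrees 2 to 10: \<open>10 * (-2)\<close>,
    \<open>10 * (-4)\<close>, \<open>10 * 3 - 20 * 9\<close>, \<open>10 * 8 - 112 * 15\<close> and
    \<open>10 * 5 - 252 * 25\<close>.\<close>
  have nd: "\<not> p dvd -20" "\<not> p dvd -40" "\<not> p dvd -150" "\<not> p dvd -1600" "\<not> p dvd -6250"
    using prime_not_dvd_const[OF p] by auto
  note px = ep[folded S5[of "\<lambda>i. x i ^ _"]]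
  note py = fp[folded S5[of "\<lambda>i. y i ^ _"]]
  note expand = sum_sum_diff_power[OF xs] sum_sum_diff_power[OF ys]
  have c2: "[e2 = f2] (mod p)"
  proof (rule prime_cong_mult_const_cancel[OF p(1) nd(1)])
    show "[-20 * e2 + 0 = -20 * f2 + 0] (mod p)"
      using D[of 2] unfolding expand px py by simp
  qed simp
  have c4: "[e4 = f4] (mod p)"
  proof (rule prime_cong_mult_const_cancel[OF p(1) nd(2)])
    have "2 * int 5 * (2 * e^2 - 4 * f) + 6 * (- 2 * e)^2 = -40 * f + 44 * e^2" for e f
      by (simp add: power2_eq_square)
    then show "[-40 * e4 + 44 * e2^2 = -40 * f4 + 44 * f2^2] (mod p)"
      using D[of 4] unfolding expand px py by simp
    show "[44 * e2^2 = 44 * f2^2] (mod p)" by (intro cong_mult cong_pow cong_refl c2)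
  qed
  have c6: "[e3^2 = f3^2] (mod p)"
  proof (rule prime_cong_mult_const_cancel[OF p(1) nd(3)])
    define w where "w e f = 10 * (- 2 * e^3 + 6 * (e * f)) + 30 * (- 2 * e) * (2 * e^2 - 4 * f)" for e f :: int
    have e: "2 * int 5 * (- 2 * e^3 + 6 * (e * f) + 3 * a^2) + 30 * (- 2 * e) * (2 * e^2 - 4 * f) - 20 * (3 * a)^2
        = -150 * a^2 + w e f" for e f a
      by (simp add: w_def algebra_simps power2_eq_square)
    show "[-150 * e3^2 + w e2 e4 = -150 * f3^2 + w f2 f4] (mod p)"
      using D[of 6] unfolding expand px py e .
    show "[w e2 e4 = w f2 f4] (mod p)" unfolding w_def
      by (intro cong_add cong_diff cong_mult cong_pow cong_refl c2 c4)
  qed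
  have c8: "[e3 * e5 = f3 * f5] (mod p)"
  proof (rule prime_cong_mult_const_cancel[OF p(1) nd(4)])
    define w where "w e f a = 10 * (2 * e^4 - 8 * (e^2 * f) - 8 * (e * a) + 4 * f^2)
      + 56 * (- 2 * e) * (- 2 * e^3 + 6 * (e * f) + 3 * a) + 1680 * e * a + 70 * (2 * e^2 - 4 * f)^2" for e f a :: int
    have e: "2 * int 5 * (2 * e^4 - 8 * (e^2 * f) - 8 * (e * a^2) + 8 * (a * b) + 4 * f^2)
      + 56 * (- 2 * e) * (- 2 * e^3 + 6 * (e * f) + 3 * a^2) - 112 * (3 * a) * (5 * b - 5 * (e * a)) 
      + 70 * (2 * e^2 - 4 * f)^2 = -1600 * (a * b) + w e f (a^2)" for e f a b
      by (simp add: w_def algebra_simps power2_eq_square)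
    show "[-1600 * (e3 * e5) + w e2 e4 (e3^2) = -1600 * (f3 * f5) + w f2 f4 (f3^2)] (mod p)"
      using D[of 8] unfolding expand px py e .
    show "[w e2 e4 (e3^2) = w f2 f4 (f3^2)] (mod p)" unfolding w_def
      by (intro cong_add cong_diff cong_mult[OF _ c6] cong_mult cong_pow cong_refl c2 c4 c6)
  qed
  have c10: "[e5^2 = f5^2] (mod p)"
  proof (rule prime_cong_mult_const_cancel[OF p(1) nd(5)])
    \<comment> \<open>The arguments \<open>a\<close> and \<open>b\<close> of this \<open>w\<close>
      stand for \<open>e3^2\<close> and \<open>e3 * e5\<close>, so the remainder involves only
      quantities already matched; in the identity that follows, \<open>a\<close> and
      \<open>b\<close> are \<open>e3\<close> and \<open>e5\<close> themselves.\<close>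
    define w where "w e f a b = 10 * (- 2 * e^5 + 10 * (e^3 * f) + 15 * (e^2 * a) - 20 * (e * b)
        - 10 * (e * f^2) - 10 * (a * f)) 
      + 90 * (- 2 * e) * (2 * e^4 - 8 * (e^2 * f) - 8 * (e * a) + 8 * b + 4 * f^2)
      - 720 * (7 * (e^2 * a) - 7 * (e * b) - 7 * (f * a)) 
      + 420 * (2 * e^2 - 4 * f) * (- 2 * e^3 + 6 * (e * f) + 3 * a)
      - 6300 * (e^2 * a - 2 * e * b)" for e f a b :: int
    have e: "2 * int 5 * (- 2 * e^5 + 10 * (e^3 * f) + 15 * (e^2 * a^2) - 20 * (e * a * b)
        - 10 * (e * f^2) - 10 * (a^2 * f) + 5 * b^2) 
      + 90 * (- 2 * e) * (2 * e^4 - 8 * (e^2 * f) - 8 * (e * a^2) + 8 * (a * b) + 4 * f^2)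
      - 240 * (3 * a) * (7 * (e^2 * a) - 7 * (e * b) - 7 * (a * f))
      + 420 * (2 * e^2 - 4 * f) * (- 2 * e^3 + 6 * (e * f) + 3 * a^2)
      - 252 * (5 * b - 5 * (e * a))^2 = -6250 * b^2 + w e f (a^2) (a * b)" for e f a b
      by (simp add: w_def algebra_simps power2_eq_square)
    show "[-6250 * e5^2 + w e2 e4 (e3^2) (e3 * e5) = -6250 * f5^2 + w f2 f4 (f3^2) (f3 * f5)] (mod p)"
      using D[of 10] unfolding expand px py e .
    have "[w a b c d = w a' b' c' d'] (mod p)" 
      if "[a = a'] (mod p)" "[b = b'] (mod p)" "[c = c'] (mod p)" "[d = d'] (mod p)" for a b c d a' b' c' d'
      unfolding w_def by (intro cong_add cong_diff cong_mult cong_pow cong_refl that)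
    then show "[w e2 e4 (e3^2) (e3 * e5) = w f2 f4 (f3^2) (f3 * f5)] (mod p)" 
      using c2 c4 c6 c8 by blast
  qed
  obtain s where s: "s \<in> {1, -1}" "[e3 = s * f3] (mod p)" "[e5 = s * f5] (mod p)"
    using prime_cong_square_imp_sign[OF p(1) c6 c8 c10] by blast
  have X: "(\<Prod>i<5. [:- x i, 1:]) = [:- e5, e4, - e3, e2, 0, 1:]"
  proof (rule poly_eq_poly_eq_iff[THEN iffD1], rule ext)
    fix t
    show "poly (\<Prod>i<5. [:- x i, 1:]) t = poly [:- e5, e4, - e3, e2, 0, 1:] t"
      unfolding Pr5 using ex[of t] by (simp add: algebra_simps numeral_eq_Suc)
  qed
  have Y: "(\<Prod>i<5. [:- (s * y i), 1:]) = [:- (s * f5), f4, - (s * f3), f2, 0, 1:]"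
  proof (rule poly_eq_poly_eq_iff[THEN iffD1], rule ext)
    fix t
    show "poly (\<Prod>i<5. [:- (s * y i), 1:]) t = poly [:- (s * f5), f4, - (s * f3), f2, 0, 1:] t"
      unfolding Pr5 using fy[of "s * t"] s(1) by (auto simp: algebra_simps numeral_eq_Suc)
  qed
  have "[:p:] dvd (\<Prod>i<5. [:- x i, 1:]) - (\<Prod>i<5. [:- (s * y i), 1:])"
    unfolding X Y using c2 c4 s(2,3)
    by (auto simp: const_poly_dvd_iff coeff_pCons cong_iff_dvd_diff dvd_diff_commute split: nat.split)
  then show ?thesis using s(1) by blast
qed

section \<open>Homometric sequences modulo an integer\<close>

text \<open>Centring asks for division by \<open>k\<close>. Multiplying by \<open>k\<close> keeps
  the sequences integral, and \<open>k\<close> is inverted modulo \<open>p\<close> only after the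
  roots have been matched. Repeated values are allowed, which matters because the lifting applies
  this to correction terms rather than to sets.\<close>

lemma homometric_mod_prime:
  fixes a b :: "nat \<Rightarrow> int" and p :: int
  assumes k: "k \<in> {4, 5}" and p: "prime p" "p > 13"
    and \<sigma>: "bij_betw \<sigma> ({..<k} \<times> {..<k}) ({..<k} \<times> {..<k})"
    and ab: "\<And>z. z \<in> {..<k} \<times> {..<k} \<Longrightarrow>
      [a (fst z) - a (snd z) = b (fst (\<sigma> z)) - b (snd (\<sigma> z))] (mod p)"
  shows "\<exists>s\<in>{1, -1}. \<exists>\<pi> v. bij_betw \<pi> {..<k} {..<k} \<and> (\<forall>i<k. [a i = s * b (\<pi> i) + v] (mod p))"
proof -
  define x where "x i = int k * a i - (\<Sum>j<k. a j)" for i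
  define y where "y i = int k * b i - (\<Sum>j<k. b j)" for i
  have x0: "(\<Sum>i<k. x i) = 0" and y0: "(\<Sum>i<k. y i) = 0"
    by (simp_all add: x_def y_def sum_subtractf flip: sum_distrib_left)
  have D: "[(\<Sum>i<k. \<Sum>j<k. (x i - x j)^m) = (\<Sum>i<k. \<Sum>j<k. (y i - y j)^m)] (mod p)" for m
  proof -
    have "[x (fst z) - x (snd z) = y (fst (\<sigma> z)) - y (snd (\<sigma> z))] (mod p)" if "z \<in> {..<k} \<times> {..<k}" for z
      using cong_mult[OF cong_refl[of "int k"] ab[OF that]] by (simp add: x_def y_def algebra_simps)
    then have "[(\<Sum>z\<in>{..<k} \<times> {..<k}. (x (fst z) - x (snd z))^m)
        = (\<Sum>z\<in>{..<k} \<times> {..<k}. (y (fst (\<sigma> z)) - y (snd (\<sigma> z)))^m)] (mod p)"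
      by (intro cong_sum cong_pow)
    also have "(\<Sum>z\<in>{..<k} \<times> {..<k}. (y (fst (\<sigma> z)) - y (snd (\<sigma> z)))^m)
        = (\<Sum>z\<in>{..<k} \<times> {..<k}. (y (fst z) - y (snd z))^m)"
      by (rule sum.reindex_bij_betw[OF \<sigma>])
    finally show ?thesis by (simp add: sum.cartesian_product case_prod_unfold)
  qed
  have "\<exists>s\<in>{1, -1}. [:p:] dvd (\<Prod>i<k. [:- x i, 1:]) - (\<Prod>i<k. [:- (s * y i), 1:])"
    using k homometric_four_mod_prime[OF p] homometric_five_mod_prime[OF p] x0 y0 D by auto
  then obtain s where s: "s \<in> {1, -1}" 
    and dvd: "[:p:] dvd (\<Prod>i<k. [:- x i, 1:]) - (\<Prod>i<k. [:- (s * y i), 1:])" by blast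
  obtain \<pi> where \<pi>: "bij_betw \<pi> {..<k} {..<k}" "\<forall>i<k. [x i = s * y (\<pi> i)] (mod p)"
    using prime_dvd_prod_linear_diff_imp_bij[OF p(1) _ _ _ dvd] by auto
  have "\<not> p dvd int k" using k p(2) by (auto dest: zdvd_imp_le)
  then have "coprime (int k) p" using prime_imp_coprime[OF p(1)] coprime_commute by blast
  then obtain c where c: "[int k * c = 1] (mod p)" using coprime_iff_invertible_int by blast
  define v where "v = c * ((\<Sum>j<k. a j) - s * (\<Sum>j<k. b j))"
  have "[a i = s * b (\<pi> i) + v] (mod p)" if "i < k" for i
  proof -
    have "[x i = s * y (\<pi> i)] (mod p)" using \<pi>(2) that by blast
    then have "[c * (x i + (\<Sum>j<k. a j)) = c * (s * y (\<pi> i) + (\<Sum>j<k. a j))] (mod p)"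
      by (intro cong_mult cong_add cong_refl)
    also have "c * (x i + (\<Sum>j<k. a j)) = int k * c * a i" by (simp add: x_def)
    also have "c * (s * y (\<pi> i) + (\<Sum>j<k. a j)) = int k * c * (s * b (\<pi> i)) + v"
      by (simp add: y_def v_def algebra_simps)
    finally have "[int k * c * a i = int k * c * (s * b (\<pi> i)) + v] (mod p)" .
    moreover have kc: "[int k * c * w = w] (mod p)" for w 
      using cong_mult[OF c cong_refl[of w]] by simp
    moreover have "[int k * c * (s * b (\<pi> i)) + v = s * b (\<pi> i) + v] (mod p)"
      by (intro cong_add kc cong_refl)
    ultimately show ?thesis using cong_sym cong_trans by blast
  qed
  then show ?thesis using s \<pi>(1) by blast
qed

lemma signed_incidence_row_diff: "signed_incidence_row n (\<lambda>c. of_bool (c = i) - of_bool (c = j))"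
  by (auto simp: signed_incidence_row_def)

text \<open>Modulo \<open>p\<close>, \<open>b\<close> is an affine image of \<open>a\<close>, so the
  difference equations become conditions on \<open>a\<close> alone, each given by a sum of two
  signed incidence rows. After \<open>a'\<close> has been lifted, \<open>b'\<close> is defined from
  it by the same affine formula, now as an equality.\<close>

lemma homometric_lift_prime:
  fixes a b :: "nat \<Rightarrow> int" and p :: int
  assumes k: "k \<in> {4, 5}" and p: "prime p" "p > 2 ^ k"
    and \<sigma>: "bij_betw \<sigma> ({..<k} \<times> {..<k}) ({..<k} \<times> {..<k})"
    and ab: "\<And>z. z \<in> {..<k} \<times> {..<k} \<Longrightarrow>
      [a (fst z) - a (snd z) = b (fst (\<sigma> z)) - b (snd (\<sigma> z))] (mod p)"
  obtains a' b' where "\<And>i. i < k \<Longrightarrow> [a' i = a i] (mod p)" "\<And>i. i < k \<Longrightarrow> [b' i = b i] (mod p)"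
    "\<And>z. z \<in> {..<k} \<times> {..<k} \<Longrightarrow> a' (fst z) - a' (snd z) = b' (fst (\<sigma> z)) - b' (snd (\<sigma> z))"
proof -
  have p13: "p > 13" using k p(2) by auto
  obtain s \<pi> v where s: "s \<in> {1, -1}" and \<pi>: "bij_betw \<pi> {..<k} {..<k}"
    and av: "\<And>i. i < k \<Longrightarrow> [a i = s * b (\<pi> i) + v] (mod p)"
    using homometric_mod_prime[OF k p(1) p13 \<sigma> ab] by blast
  define \<rho> where "\<rho> = inv_into {..<k} \<pi>"
  have \<rho>: "\<rho> j < k" "\<pi> (\<rho> j) = j" if "j < k" for j
    using that \<pi> unfolding \<rho>_def bij_betw_def
    by (metis inv_into_into lessThan_iff, metis f_inv_into_f lessThan_iff)
  have ss: "s * (s * t) = t" for t using s by auto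
  have bv: "[b j = s * a (\<rho> j) - s * v] (mod p)" if "j < k" for j
  proof -
    have "[s * a (\<rho> j) - s * v = s * (s * b (\<pi> (\<rho> j)) + v) - s * v] (mod p)"
      by (intro cong_diff cong_mult cong_refl av \<rho> that)
    then show ?thesis using \<rho>(2)[OF that] by (simp add: algebra_simps ss cong_sym)
  qed
  \<comment> \<open>The sign is absorbed by the order of the pair, so that the second part of
    \<open>f z\<close> is again a difference of two unit vectors: for \<open>s = 1\<close> a
    difference is subtracted, hence reversed.\<close>
  define r where "r z = (if s = 1 then (\<rho> (snd (\<sigma> z)), \<rho> (fst (\<sigma> z))) else (\<rho> (fst (\<sigma> z)), \<rho> (snd (\<sigma> z))))" for z
  define f where "f z = (\<lambda>c. (of_bool (c = fst z) - of_bool (c = snd z)) 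
      + (of_bool (c = fst (r z)) - of_bool (c = snd (r z))) :: int)" for z :: "nat \<times> nat"
  have \<sigma>k: "fst (\<sigma> z) < k" "snd (\<sigma> z) < k" if "z \<in> {..<k} \<times> {..<k}" for z
    using bij_betw_apply[OF \<sigma> that] by (auto simp: mem_Times_iff)
  have pick: "(\<Sum>c<k. of_bool (c = i) * x c) = x i" if "i < k" for i and x :: "nat \<Rightarrow> int"
    using that by (subst sum.remove[of _ i]) auto
  have fx: "(\<Sum>c<k. f z c * x c) = x (fst z) - x (snd z) - s * (x (\<rho> (fst (\<sigma> z))) - x (\<rho> (snd (\<sigma> z))))"
    if z: "z \<in> {..<k} \<times> {..<k}" for z x
  proof -
    have "fst (r z) < k" "snd (r z) < k" using \<sigma>k[OF z] \<rho>(1) by (auto simp: r_def)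
    then have "(\<Sum>c<k. f z c * x c) = x (fst z) - x (snd z) + (x (fst (r z)) - x (snd (r z)))"
      using z by (simp add: f_def distrib_right left_diff_distrib sum.distrib sum_subtractf pick mem_Times_iff)
    then show ?thesis using s by (auto simp: r_def)
  qed
  obtain a' where a': "\<And>c. c < k \<Longrightarrow> [a' c = a c] (mod p)"
    and fa': "\<And>g. g \<in> f ` ({..<k} \<times> {..<k}) \<Longrightarrow> (\<Sum>c<k. g c * a' c) = 0"
  proof (rule prime_lift_of_two_signed_incidence[OF p, of "f ` ({..<k} \<times> {..<k})" a])
    show "\<exists>h h'. signed_incidence_row k h \<and> signed_incidence_row k h' \<and> g = (\<lambda>j. h j + h' j)" 
      if "g \<in> f ` ({..<k} \<times> {..<k})" for g
      using that signed_incidence_row_diff unfolding f_def by blast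
    show "p dvd (\<Sum>c<k. g c * a c)" if g: "g \<in> f ` ({..<k} \<times> {..<k})" for g
    proof -
      obtain z where z: "z \<in> {..<k} \<times> {..<k}" "g = f z" using g by blast
      have "[b (fst (\<sigma> z)) - b (snd (\<sigma> z)) 
          = (s * a (\<rho> (fst (\<sigma> z))) - s * v) - (s * a (\<rho> (snd (\<sigma> z))) - s * v)] (mod p)"
        by (intro cong_diff bv \<sigma>k z)
      with ab[OF z(1)] have "[a (fst z) - a (snd z) = s * (a (\<rho> (fst (\<sigma> z))) - a (\<rho> (snd (\<sigma> z))))] (mod p)"
        by (simp add: algebra_simps) (use cong_trans in blast)
      then show ?thesis unfolding z(2) fx[OF z(1)] by (simp add: cong_iff_dvd_diff)
    qed
  qed blast
  define b' where "b' j = s * a' (\<rho> j) - s * v" for j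
  show ?thesis
  proof (rule that[of a' b'])
    show "[b' j = b j] (mod p)" if "j < k" for j
    proof -
      have "[b' j = s * a (\<rho> j) - s * v] (mod p)" unfolding b'_def
        by (intro cong_diff cong_mult cong_refl a' \<rho> that)
      then show ?thesis using bv[OF that] cong_sym cong_trans by blast
    qed
    show "a' (fst z) - a' (snd z) = b' (fst (\<sigma> z)) - b' (snd (\<sigma> z))" if z: "z \<in> {..<k} \<times> {..<k}" for z
      using fa'[of "f z"] z fx[OF z, of a'] by (simp add: b'_def algebra_simps)
  qed (rule a')
qed

text \<open>With \<open>n = p * m\<close>, an exact solution that is correct modulo \<open>m\<close>
  leaves corrections \<open>x\<close> and \<open>y\<close>. They satisfy the same equations modulo
  \<open>p\<close>, since these are linear and homogeneous and \<open>\<sigma>\<close> stays fixed.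
  Exact lifts of the corrections, multiplied by \<open>m\<close>, complete the solution.\<close>

lemma homometric_lift:
  fixes a b :: "nat \<Rightarrow> int" and n :: nat
  assumes k: "k \<in> {4, 5}" and n: "n > 0" "\<And>p. prime p \<Longrightarrow> p dvd n \<Longrightarrow> p > 2 ^ k"
    and \<sigma>: "bij_betw \<sigma> ({..<k} \<times> {..<k}) ({..<k} \<times> {..<k})"
    and ab: "\<And>z. z \<in> {..<k} \<times> {..<k} \<Longrightarrow>
      [a (fst z) - a (snd z) = b (fst (\<sigma> z)) - b (snd (\<sigma> z))] (mod int n)"
  shows "\<exists>a' b'. (\<forall>i<k. [a' i = a i] (mod int n)) \<and> (\<forall>i<k. [b' i = b i] (mod int n)) \<and>
    (\<forall>z\<in>{..<k} \<times> {..<k}. a' (fst z) - a' (snd z) = b' (fst (\<sigma> z)) - b' (snd (\<sigma> z)))"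
  using n ab
proof (induction n arbitrary: a b rule: less_induct)
  case (less n)
  show ?case
  proof (cases "n = 1")
    case True
    then show ?thesis by (intro exI[of _ "\<lambda>_. 0"]) auto
  next
    case False
    then obtain p where p: "prime p" "p dvd n" using prime_factor_nat by blast
    then obtain m where m: "n = p * m" by blast
    have m0: "m > 0" "m < n" using m less.prems(1) prime_gt_1_nat[OF p(1)] by auto
    have nm: "int n = int m * int p" using m by simp
    have \<sigma>k: "fst (\<sigma> z) < k" "snd (\<sigma> z) < k" if "z \<in> {..<k} \<times> {..<k}" for z
      using bij_betw_apply[OF \<sigma> that] by (auto simp: mem_Times_iff)
    have "\<exists>a' b'. (\<forall>i<k. [a' i = a i] (mod int m)) \<and> (\<forall>i<k. [b' i = b i] (mod int m)) \<and>
      (\<forall>z\<in>{..<k} \<times> {..<k}. a' (fst z) - a' (snd z) = b' (fst (\<sigma> z)) - b' (snd (\<sigma> z)))"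
    proof (rule less.IH[OF m0(2,1)])
      show "2 ^ k < q" if "prime q" "q dvd m" for q using less.prems(2)[of q] that m by simp
      show "[a (fst z) - a (snd z) = b (fst (\<sigma> z)) - b (snd (\<sigma> z))] (mod int m)" 
        if "z \<in> {..<k} \<times> {..<k}" for z
        using less.prems(3)[OF that] nm cong_dvd_modulus by (metis dvd_triv_left)
    qed
    then obtain a0 b0 where a0: "\<And>i. i < k \<Longrightarrow> [a0 i = a i] (mod int m)"
      and b0: "\<And>i. i < k \<Longrightarrow> [b0 i = b i] (mod int m)"
      and ab0: "\<And>z. z \<in> {..<k} \<times> {..<k} \<Longrightarrow> a0 (fst z) - a0 (snd z) = b0 (fst (\<sigma> z)) - b0 (snd (\<sigma> z))"
      by blast
    define x where "x i = (a i - a0 i) div int m" for i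
    define y where "y i = (b i - b0 i) div int m" for i
    have x: "a i = a0 i + int m * x i" if "i < k" for i
      using a0[OF that] by (simp add: x_def cong_iff_dvd_diff dvd_diff_commute)
    have y: "b i = b0 i + int m * y i" if "i < k" for i
      using b0[OF that] by (simp add: y_def cong_iff_dvd_diff dvd_diff_commute)
    have xy: "[x (fst z) - x (snd z) = y (fst (\<sigma> z)) - y (snd (\<sigma> z))] (mod int p)" 
      if z: "z \<in> {..<k} \<times> {..<k}" for z
    proof -
      have "a (fst z) - a (snd z) - (b (fst (\<sigma> z)) - b (snd (\<sigma> z)))
          = int m * (x (fst z) - x (snd z) - (y (fst (\<sigma> z)) - y (snd (\<sigma> z))))"
        using ab0[OF z] x[of "fst z"] x[of "snd z"] y[OF \<sigma>k(1)[OF z]] y[OF \<sigma>k(2)[OF z]] z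
        by (simp add: mem_Times_iff algebra_simps)
      then show ?thesis using less.prems(3)[OF z] m0(1) unfolding nm cong_iff_dvd_diff by simp
    qed
    have p': "prime (int p)" "2 ^ k < int p" using p less.prems(2)[OF p]
      by (auto simp: of_nat_less_iff[symmetric] simp del: of_nat_less_iff)
    obtain x' y' where x': "\<And>i. i < k \<Longrightarrow> [x' i = x i] (mod int p)" 
      and y': "\<And>i. i < k \<Longrightarrow> [y' i = y i] (mod int p)"
      and xy': "\<And>z. z \<in> {..<k} \<times> {..<k} \<Longrightarrow> x' (fst z) - x' (snd z) = y' (fst (\<sigma> z)) - y' (snd (\<sigma> z))"
      by (rule homometric_lift_prime[OF k p' \<sigma> xy]) blast+
    have c: "[u + int m * t' = u + int m * t] (mod int n)" if "[t' = t] (mod int p)" for u t t'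
      using that unfolding nm cong_iff_dvd_diff by (simp flip: right_diff_distrib)
    show ?thesis
    proof (intro exI conjI allI impI ballI)
      show "[a0 i + int m * x' i = a i] (mod int n)" if "i < k" for i
        unfolding x[OF that] by (rule c[OF x'[OF that]])
      show "[b0 i + int m * y' i = b i] (mod int n)" if "i < k" for i
        unfolding y[OF that] by (rule c[OF y'[OF that]])
      show "a0 (fst z) + int m * x' (fst z) - (a0 (snd z) + int m * x' (snd z))
        = b0 (fst (\<sigma> z)) + int m * y' (fst (\<sigma> z)) - (b0 (snd (\<sigma> z)) + int m * y' (snd (\<sigma> z)))"
        if "z \<in> {..<k} \<times> {..<k}" for z
      proof -
        have "int m * (x' (fst z) - x' (snd z)) = int m * (y' (fst (\<sigma> z)) - y' (snd (\<sigma> z)))" 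
          using xy'[OF that] by simp
        then show ?thesis using ab0[OF that] by (simp add: algebra_simps)
      qed
    qed
  qed
qed

text \<open>The lifted sequences satisfy the difference equations over the integers, hence modulo
  every prime. A prime beyond the size of all terms turns the affine congruence into an equality,
  which is then reduced modulo \<open>n\<close>.\<close>

theorem homometric_mod:
  fixes a b :: "nat \<Rightarrow> int" and n :: nat
  assumes k: "k \<in> {4, 5}" and n: "n > 0" "\<And>p. prime p \<Longrightarrow> p dvd n \<Longrightarrow> p > 2 ^ k"
    and \<sigma>: "bij_betw \<sigma> ({..<k} \<times> {..<k}) ({..<k} \<times> {..<k})"
    and ab: "\<And>z. z \<in> {..<k} \<times> {..<k} \<Longrightarrow>
      [a (fst z) - a (snd z) = b (fst (\<sigma> z)) - b (snd (\<sigma> z))] (mod int n)"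
  shows "\<exists>s\<in>{1, -1}. \<exists>\<pi> v. bij_betw \<pi> {..<k} {..<k} \<and> (\<forall>i<k. [a i = s * b (\<pi> i) + v] (mod int n))"
proof -
  obtain a' b' where a': "\<And>i. i < k \<Longrightarrow> [a' i = a i] (mod int n)"
    and b': "\<And>i. i < k \<Longrightarrow> [b' i = b i] (mod int n)"
    and ab': "\<And>z. z \<in> {..<k} \<times> {..<k} \<Longrightarrow> a' (fst z) - a' (snd z) = b' (fst (\<sigma> z)) - b' (snd (\<sigma> z))"
    using homometric_lift[OF k n \<sigma> ab] by blast
  define M where "M = (\<Sum>i<k. \<bar>a' i\<bar>) + (\<Sum>i<k. \<bar>b' i\<bar>)"
  have M0: "0 \<le> M" unfolding M_def by (intro add_nonneg_nonneg sum_nonneg) auto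
  have aM: "\<bar>a' i\<bar> \<le> M" if "i < k" for i
    unfolding M_def using that member_le_sum[of i "{..<k}" "\<lambda>i. \<bar>a' i\<bar>"] 
    by (intro add_increasing2 sum_nonneg) auto
  have bM: "\<bar>b' i\<bar> \<le> M" if "i < k" for i
    unfolding M_def using that member_le_sum[of i "{..<k}" "\<lambda>i. \<bar>b' i\<bar>"] 
    by (intro add_increasing sum_nonneg) auto
  obtain P :: nat where P: "prime P" "P > 13 + nat (4 * M)" using bigger_prime by blast
  have P': "prime (int P)" "int P > 13" "int P > 4 * M" using P M0 by auto
  obtain s \<pi> v where s: "s \<in> {1, -1}" and \<pi>: "bij_betw \<pi> {..<k} {..<k}"
    and av: "\<And>i. i < k \<Longrightarrow> [a' i = s * b' (\<pi> i) + v] (mod int P)"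
    using homometric_mod_prime[OF k P'(1,2) \<sigma>, of a' b'] ab' cong_refl by metis
  have k0: "0 < k" using k by auto
  have \<pi>k: "\<pi> i < k" if "i < k" for i using bij_betwE[OF \<pi>] that by auto
  \<comment> \<open>Subtracting the relation for index \<open>0\<close> eliminates \<open>v\<close>,
    which is known only modulo \<open>P\<close> and has no bound. The remaining four terms are at
    most \<open>M\<close> each, whence \<open>4 * M\<close>.\<close>
  have ex: "a' i - a' 0 = s * (b' (\<pi> i) - b' (\<pi> 0))" if i: "i < k" for i
  proof -
    have "[a' i - a' 0 = (s * b' (\<pi> i) + v) - (s * b' (\<pi> 0) + v)] (mod int P)"
      by (intro cong_diff av i k0)
    then have "int P dvd a' i - a' 0 - s * (b' (\<pi> i) - b' (\<pi> 0))"
      by (simp add: cong_iff_dvd_diff algebra_simps)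
    moreover have "\<bar>a' i - a' 0 - s * (b' (\<pi> i) - b' (\<pi> 0))\<bar> \<le> 4 * M"
      using s aM[OF i] aM[OF k0] bM[OF \<pi>k[OF i]] bM[OF \<pi>k[OF k0]] by auto
    ultimately have "a' i - a' 0 - s * (b' (\<pi> i) - b' (\<pi> 0)) = 0"
      using P'(3) dvd_imp_le_int[of "a' i - a' 0 - s * (b' (\<pi> i) - b' (\<pi> 0))" "int P"] by linarith
    then show ?thesis by simp
  qed
  have "[a i = s * b (\<pi> i) + (a' 0 - s * b' (\<pi> 0))] (mod int n)" if i: "i < k" for i
  proof -
    have "[a i = a' i] (mod int n)" using a'[OF i] by (rule cong_sym)
    also have "a' i = s * b' (\<pi> i) + (a' 0 - s * b' (\<pi> 0))" using ex[OF i] by (simp add: algebra_simps)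
    also have "[\<dots> = s * b (\<pi> i) + (a' 0 - s * b' (\<pi> 0))] (mod int n)"
      by (intro cong_add cong_mult cong_refl b' \<pi>k i)
    finally show ?thesis .
  qed
  then show ?thesis using s \<pi> by blast
qed

section \<open>Short vanishing sums of roots of unity\<close>

definition unity_root :: "nat \<Rightarrow> complex" where
  "unity_root n = cis (2 * pi / real n)"

lemma norm_unity_root [simp]: "norm (unity_root n) = 1"
  by (simp add: unity_root_def)

lemma unity_root_nonzero [simp]: "unity_root n \<noteq> 0"
  by (simp add: unity_root_def)

lemma unity_root_power_self: "n > 0 \<Longrightarrow> unity_root n ^ n = 1"
  by (simp add: unity_root_def DeMoivre)

lemma unity_root_power_mod: "n > 0 \<Longrightarrow> unity_root n ^ (k mod n) = unity_root n ^ k"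
  by (metis mult_div_mod_eq power_add power_mult unity_root_power_self power_one mult_1)

lemma unity_root_power_cong:
  "n > 0 \<Longrightarrow> [k = l] (mod n) \<Longrightarrow> unity_root n ^ k = unity_root n ^ l"
  by (metis cong_def unity_root_power_mod)

lemma unity_root_power_eq_1_iff:
  assumes "n > 0"
  shows "unity_root n ^ k = 1 \<longleftrightarrow> n dvd k"
proof
  assume "unity_root n ^ k = 1"
  then have "cis (2 * pi * real (k mod n) / real n) = cis (2 * pi * real 0 / real n)"
    using assms unity_root_power_mod[OF assms, of k] by (simp add: unity_root_def DeMoivre mult_ac)
  then have "k mod n = 0"
    using bij_betw_roots_unity[OF assms] assms unfolding bij_betw_def inj_on_def
    by (metis lessThan_iff mod_less_divisor)
  then show "n dvd k" by auto
next
  assume "n dvd k"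
  then show "unity_root n ^ k = 1" using assms by (auto simp: power_mult unity_root_power_self)
qed

lemma unity_root_mult_power:
  assumes "p > 0" "m > 0"
  shows "unity_root (p * m) ^ p = unity_root m"
  using assms by (simp add: unity_root_def DeMoivre)

lemma sum_unity_root_power:
  assumes "n > 0"
  shows "(\<Sum>i<n. unity_root n ^ (i * d)) = (if n dvd d then of_nat n else 0)"
proof (cases "n dvd d")
  case True
  then have "unity_root n ^ (i * d) = 1" for i using unity_root_power_eq_1_iff[OF assms] by simp
  then show ?thesis using True by simp
next
  case False
  let ?z = "unity_root n ^ d"
  have z: "?z \<noteq> 1" using False unity_root_power_eq_1_iff[OF assms] by simp
  have "?z ^ n = 1" using assms by (metis power_mult mult.commute unity_root_power_self power_one)
  then have "(\<Sum>i<n. ?z ^ i) = 0" using geometric_sum[OF z, of n] by simp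
  then show ?thesis using False by (simp add: power_mult[symmetric] mult.commute)
qed

section \<open>Integer polynomials at conjugate roots of unity\<close>

lemma of_nat_prime_dvd_freshman:
  fixes x y :: "'a::comm_ring_1"
  assumes "prime q"
  shows "of_nat q dvd (x + y) ^ q - (x ^ q + y ^ q)"
proof -
  have q: "q > 0" using assms prime_gt_0_nat by blast
  have "(x + y) ^ q = (\<Sum>k\<le>q. of_nat (q choose k) * x ^ k * y ^ (q - k))" by (rule binomial_ring)
  also have "{..q} = insert 0 (insert q {0<..<q})" using q by auto
  also have "(\<Sum>k\<in>\<dots>. of_nat (q choose k) * x ^ k * y ^ (q - k))
      = y ^ q + (x ^ q + (\<Sum>k\<in>{0<..<q}. of_nat (q choose k) * x ^ k * y ^ (q - k)))"
    using q by simp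
  finally have "(x + y) ^ q - (x ^ q + y ^ q) = (\<Sum>k\<in>{0<..<q}. of_nat (q choose k) * x ^ k * y ^ (q - k))"
    by simp
  also have "of_nat q dvd \<dots>"
  proof (rule dvd_sum)
    fix k assume "k \<in> {0<..<q}"
    then have "q dvd (q choose k)" using dvd_choose_prime[of k q] assms by simp
    then have "(of_nat q :: 'a) dvd of_nat (q choose k)" by (auto simp: dvd_def)
    then show "of_nat q dvd of_nat (q choose k) * x ^ k * y ^ (q - k)" by (simp add: mult.assoc dvd_mult2)
  qed
  finally show ?thesis .
qed

lemma int_prime_dvd_power_minus_self:
  fixes a :: int
  assumes "prime q"
  shows "int q dvd a ^ q - a"
proof -
  have q: "q > 0" using assms prime_gt_0_nat by blast
  have *: "int q dvd int m ^ q - int m" for m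
  proof (induction m)
    case 0
    then show ?case using q by (simp add: zero_power)
  next
    case (Suc m)
    have "int q dvd (int m + 1) ^ q - (int m ^ q + 1 ^ q)"
      using of_nat_prime_dvd_freshman[OF assms, of "int m" 1] by simp
    from dvd_add[OF this Suc.IH] show ?case by (simp add: algebra_simps)
  qed
  have "[a = int (nat (a mod int q))] (mod int q)" using q by simp
  then have "[a ^ q - a = int (nat (a mod int q)) ^ q - int (nat (a mod int q))] (mod int q)"
    by (intro cong_diff cong_pow)
  then show ?thesis using * cong_dvd_iff cong_sym by (metis cong_0_iff cong_trans)
qed

text \<open>Induction on the coefficients: the freshman congruence separates the constant term from
  \<open>X * f\<close>, Fermat's little theorem treats the constant, and \<open>X ^ q\<close> is
  already the image of \<open>X\<close>.\<close>

lemma of_nat_prime_dvd_poly_frobenius: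
  fixes f :: "int poly"
  assumes "prime q"
  shows "of_nat q dvd f ^ q - pcompose f (monom 1 q)"
proof (induction f)
  case 0
  have "q > 0" using assms prime_gt_0_nat by blast
  then show ?case by (simp add: zero_power)
next
  case (pCons a f)
  define X :: "int poly" where "X = [:0, 1:]"
  have Xq: "monom 1 q = X ^ q" by (simp add: X_def monom_altdef)
  have fa: "pCons a f = [:a:] + X * f" by (simp add: X_def)
  have "pcompose (pCons a f) (X ^ q) = [:a:] + X ^ q * pcompose f (X ^ q)" by (simp add: pcompose_pCons)
  then have "pCons a f ^ q - pcompose (pCons a f) (X ^ q) =
     (([:a:] + X * f) ^ q - ([:a:] ^ q + (X * f) ^ q)) + ([:a:] ^ q - [:a:]) 
       + X ^ q * (f ^ q - pcompose f (X ^ q))"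
    unfolding fa by (simp add: algebra_simps)
  moreover have "of_nat q dvd ([:a:] + X * f) ^ q - ([:a:] ^ q + (X * f) ^ q)"
    by (rule of_nat_prime_dvd_freshman[OF assms])
  moreover have "of_nat q dvd [:a:] ^ q - [:a:]"
  proof -
    obtain b where "a ^ q - a = int q * b" using int_prime_dvd_power_minus_self[OF assms, of a] by (auto elim: dvdE)
    then have "[:a:] ^ q - [:a:] = of_nat q * [:b:]" by (simp add: poly_const_pow of_nat_poly)
    then show ?thesis by (rule dvdI)
  qed
  moreover have "of_nat q dvd X ^ q * (f ^ q - pcompose f (X ^ q))"
    using pCons.IH unfolding Xq by (rule dvd_mult)
  ultimately show ?case unfolding Xq by (metis dvd_add)
qed

abbreviation cpoly :: "int poly \<Rightarrow> complex \<Rightarrow> complex" where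
  "cpoly f z \<equiv> poly (of_int_poly f) z"

lemma cpoly_altdef: "cpoly f z = (\<Sum>i\<le>degree f. of_int (coeff f i) * z ^ i)"
  by (simp add: poly_altdef coeff_map_poly degree_map_poly)

text \<open>For \<open>r < n\<close> the integer \<open>c\<close> is the coefficient of
  \<open>X ^ r\<close> after reduction of \<open>P\<close> modulo \<open>X ^ n - 1\<close>. The
  exponent \<open>n - r\<close> represents \<open>- r\<close> within \<open>nat\<close>.\<close>

lemma fourier_coefficient_int:
  assumes n: "n > 0"
  obtains c :: int where
    "(\<Sum>i<n. cpoly P (unity_root n ^ i) * unity_root n ^ (i * (n - r))) = of_nat n * of_int c"
proof -
  let ?z = "unity_root n"
  define c where "c = (\<Sum>k\<le>degree P. if n dvd k + (n - r) then coeff P k else 0)"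
  have "(\<Sum>i<n. cpoly P (?z ^ i) * ?z ^ (i * (n - r)))
     = (\<Sum>i<n. \<Sum>k\<le>degree P. of_int (coeff P k) * ?z ^ (i * (k + (n - r))))"
    unfolding cpoly_altdef sum_distrib_right
    by (intro sum.cong refl) (simp add: power_mult[symmetric] power_add[symmetric] mult.assoc distrib_left)
  also have "\<dots> = (\<Sum>k\<le>degree P. of_int (coeff P k) * (\<Sum>i<n. ?z ^ (i * (k + (n - r)))))"
    by (subst sum.swap) (simp add: sum_distrib_left)
  also have "\<dots> = of_nat n * of_int c"
    unfolding sum_unity_root_power[OF n] c_def of_int_sum sum_distrib_left
    by (intro sum.cong refl) auto
  finally show ?thesis by (rule that)
qed

lemma fourier_inversion:
  assumes n: "n > 0"
    and "\<And>r. r < n \<Longrightarrow> (\<Sum>i<n. g i * unity_root n ^ (i * (n - r))) = 0" and j: "j < n"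
  shows "g j = 0"
proof -
  let ?z = "unity_root n"
  have "0 = (\<Sum>r<n. (\<Sum>i<n. g i * ?z ^ (i * (n - r))) * ?z ^ (j * r))" using assms(2) by simp
  also have "\<dots> = (\<Sum>i<n. g i * (\<Sum>r<n. ?z ^ (i * (n - r) + j * r)))"
    unfolding sum_distrib_left sum_distrib_right
    by (subst sum.swap) (simp add: power_add mult.assoc)
  also have "\<dots> = (\<Sum>i<n. g i * (\<Sum>r<n. ?z ^ (r * (j + (n - i)))))"
  proof (intro sum.cong refl arg_cong2[of _ _ _ _ "(*)"])
    fix i r assume ir: "i \<in> {..<n}" "r \<in> {..<n}"
    have "int (i * (n - r) + j * r) = int (r * (j + (n - i))) + int n * (int i - int r)"
      using ir by (simp add: of_nat_diff ring_distribs)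
    then have "[int (i * (n - r) + j * r) = int (r * (j + (n - i)))] (mod int n)"
      by (simp add: cong_iff_dvd_diff)
    then show "?z ^ (i * (n - r) + j * r) = ?z ^ (r * (j + (n - i)))"
      by (intro unity_root_power_cong n) (simp only: cong_int_iff)
  qed
  also have "\<dots> = (\<Sum>i<n. if i = j then g j * of_nat n else 0)"
  proof (intro sum.cong refl)
    fix i assume i: "i \<in> {..<n}"
    have "n dvd j + (n - i) \<longleftrightarrow> i = j"
    proof
      assume "n dvd j + (n - i)"
      then obtain q where q: "j + (n - i) = n * q" by (elim dvdE)
      have "0 < j + (n - i)" "j + (n - i) < n * 2" using i j by auto
      then have "0 < q" "q < 2" unfolding q by (auto simp: mult_less_cancel1)
      then have "q = 1" by simp
      then show "i = j" using q i by auto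
    qed (use i in auto)
    then show "g i * (\<Sum>r<n. ?z ^ (r * (j + (n - i)))) = (if i = j then g j * of_nat n else 0)"
      unfolding sum_unity_root_power[OF n] by auto
  qed
  also have "\<dots> = g j * of_nat n" using j by simp
  finally show ?thesis using n by simp
qed

lemma rat_poly_clear_denominators:
  fixes w :: "rat poly"
  obtains d :: int and v :: "int poly" where "d \<noteq> 0" "of_int_poly v = Polynomial.smult (of_int d) w"
proof (induction w arbitrary: thesis)
  case 0
  show ?case by (rule 0[of 1 0]) auto
next
  case (pCons a w)
  obtain d v where dv: "d \<noteq> 0" "of_int_poly v = Polynomial.smult (of_int d) w" using pCons.IH by blast
  obtain x y where xy: "quotient_of a = (x, y)" by force
  have y: "y \<noteq> 0" using quotient_of_denom_pos[OF xy] by simp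
  have a: "of_int y * a = of_int x" using quotient_of_div[OF xy] y by simp
  have cv: "of_int (coeff v i) = of_int d * coeff w i" for i
    using arg_cong[OF dv(2), of "\<lambda>p. coeff p i"] by (simp add: coeff_map_poly)
  show ?case
  proof (rule pCons.prems)
    show "d * y \<noteq> 0" using dv y by simp
    show "of_int_poly (pCons (d * x) (Polynomial.smult y v)) = Polynomial.smult (of_int (d * y)) (pCons a w)"
      using a cv by (intro poly_eqI) (simp add: coeff_map_poly coeff_pCons ac_simps split: nat.split)
  qed
qed

lemma norm_cpoly_le:
  assumes "norm z = 1"
  shows "norm (cpoly f z) \<le> of_int (\<Sum>i\<le>degree f. \<bar>coeff f i\<bar>)"
proof -
  have "norm (cpoly f z) \<le> (\<Sum>i\<le>degree f. norm (of_int (coeff f i) * z ^ i))"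
    unfolding cpoly_altdef by (rule norm_sum)
  also have "\<dots> = of_int (\<Sum>i\<le>degree f. \<bar>coeff f i\<bar>)"
    using assms by (simp add: norm_mult norm_power)
  finally show ?thesis .
qed

text \<open>\<open>v\<close> is a nonzero integer multiple of
  \<open>(X ^ n - 1) / gcd(f, X ^ n - 1)\<close>, taken over the rationals. The gcd vanishes at
  \<open>z\<close> by Bezout, and \<open>X ^ n - 1\<close> has simple roots, so the quotient does
  not. At an \<open>n\<close>-th root of unity where \<open>f\<close> is nonzero the gcd is nonzero,
  so the quotient vanishes.\<close>

lemma exists_complementary_factor:
  fixes f :: "int poly" and z :: complex
  assumes n: "n > 0" and z: "z ^ n = 1" "cpoly f z = 0"
  obtains v :: "int poly" where "cpoly v z \<noteq> 0" "\<And>y. y ^ n = 1 \<Longrightarrow> cpoly f y \<noteq> 0 \<Longrightarrow> cpoly v y = 0"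
proof -
  let ?c = "map_poly (of_rat :: rat \<Rightarrow> complex)"
  interpret rp: map_poly_comm_ring_hom "of_rat :: rat \<Rightarrow> complex" ..
  define F :: "rat poly" where "F = of_int_poly f"
  define X :: "rat poly" where "X = monom 1 n - 1"
  define g where "g = gcd F X"
  have mult: "poly (?c (P * Q)) y = poly (?c P) y * poly (?c Q) y" for P Q y
    by (simp add: rp.hom_mult)
  have add: "poly (?c (P + Q)) y = poly (?c P) y + poly (?c Q) y" for P Q y
    by (simp add: rp.hom_add)
  have Fy: "poly (?c F) y = cpoly f y" for y
    unfolding F_def by (simp add: map_poly_map_poly o_def)
  have Xc: "?c X = monom 1 n - 1" 
    unfolding X_def by (rule poly_eqI) (simp add: coeff_map_poly of_rat_diff)
  have Xy: "poly (?c X) y = y ^ n - 1" for y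
    unfolding Xc by (simp add: poly_monom)
  obtain w where w: "X = g * w" unfolding g_def by (meson dvdE gcd_dvd2)
  obtain u where u: "F = g * u" unfolding g_def by (meson dvdE gcd_dvd1)
  obtain r s where rs: "r * F + s * X = g" unfolding g_def using bezout_coefficients_fst_snd by blast
  have g0: "poly (?c g) z = 0" unfolding rs[symmetric] add mult Fy Xy using z by simp
  have w0: "poly (?c w) z \<noteq> 0"
  proof
    assume w0: "poly (?c w) z = 0"
    have "poly (pderiv (?c X)) z = of_nat n * z ^ (n - 1)"
      unfolding Xc by (simp add: pderiv_diff pderiv_monom poly_monom)
    moreover have "z \<noteq> 0" using z n by (auto simp: zero_power)
    moreover have "?c X = ?c g * ?c w" unfolding w by (rule rp.hom_mult)
    ultimately show False using n g0 w0 by (simp add: pderiv_mult)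
  qed
  obtain d v where dv: "d \<noteq> 0" "of_int_poly v = Polynomial.smult (of_int d) w"
    by (rule rat_poly_clear_denominators)
  have vy: "cpoly v y = of_int d * poly (?c w) y" for y
  proof -
    have "cpoly v y = poly (?c (of_int_poly v)) y" by (simp add: map_poly_map_poly o_def)
    then show ?thesis unfolding dv(2) by (simp add: map_poly_smult of_rat_mult)
  qed
  show ?thesis
  proof (rule that[of v])
    show "cpoly v z \<noteq> 0" unfolding vy using dv w0 by simp
    fix y assume y: "y ^ n = 1" "cpoly f y \<noteq> 0"
    have "poly (?c g) y * poly (?c w) y = 0" using Xy[of y] y(1) unfolding w mult by simp
    moreover have "poly (?c g) y \<noteq> 0" using Fy[of y] y(2) unfolding u mult by auto
    ultimately show "cpoly v y = 0" unfolding vy by simp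
  qed
qed

text \<open>
  This replaces the irreducibility of cyclotomic polynomials. Write \<open>f(x)\<^sup>q - f(x\<^sup>q) = q h(x)\<close> and take an integer
  polynomial \<open>v\<close> with \<open>f v = 0\<close> at all \<open>n\<close>-th roots of unity. There \<open>q\<^sup>m h\<^sup>m v\<close> agrees up to sign with \<open>f(x\<^sup>q)\<^sup>m v\<close>, which
  grows more slowly than \<open>q\<^sup>m\<close>; so for large \<open>m\<close> the integral Fourier coefficients of \<open>h\<^sup>m v\<close> vanish.
\<close>

lemma cpoly_root_power_large_prime:
  fixes f :: "int poly"
  assumes n: "n > 0" and q: "prime q" "(\<Sum>i\<le>degree f. \<bar>coeff f i\<bar>) < int q"
    and root: "cpoly f (unity_root n ^ j) = 0"
  shows "cpoly f (unity_root n ^ (j * q)) = 0"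
proof -
  let ?z = "unity_root n"
  have q0: "q > 0" using q(1) prime_gt_0_nat by blast
  obtain h where h: "f ^ q - pcompose f (monom 1 q) = of_nat q * h"
    using of_nat_prime_dvd_poly_frobenius[OF q(1), of f] by (elim dvdE)
  have hz: "cpoly f z ^ q - cpoly f (z ^ q) = of_nat q * cpoly h z" for z
  proof -
    have "cpoly (f ^ q - pcompose f (monom 1 q)) z = cpoly f z ^ q - cpoly f (z ^ q)"
      by (simp add: of_int_hom.map_poly_pcompose of_int_poly_hom.hom_minus of_int_poly_hom.hom_power 
          poly_pcompose poly_monom)
    then show ?thesis unfolding h by (simp add: of_nat_poly map_poly_smult)
  qed
  have zn: "(?z ^ i) ^ n = 1" for i
    by (metis n mult.commute power_mult power_one unity_root_power_self)
  obtain v where v: "cpoly v (?z ^ j) \<noteq> 0" 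
    and vf: "\<And>y. y ^ n = 1 \<Longrightarrow> cpoly f y \<noteq> 0 \<Longrightarrow> cpoly v y = 0"
    using exists_complementary_factor[OF n zn root] by blast
  define C where "C = real_of_int (\<Sum>i\<le>degree f. \<bar>coeff f i\<bar>)"
  define V where "V = real_of_int (\<Sum>i\<le>degree v. \<bar>coeff v i\<bar>)"
  have C: "norm (cpoly f (?z ^ i)) \<le> C" and V: "norm (cpoly v (?z ^ i)) \<le> V" for i
    unfolding C_def V_def by (rule norm_cpoly_le, simp add: norm_power)+
  have C0: "0 \<le> C" and V0: "0 \<le> V" unfolding C_def V_def by (simp_all add: sum_nonneg)
  have "C < real q" using q(2) unfolding C_def by (metis of_int_less_iff of_int_of_nat_eq)
  then have "C / q < 1" using q0 by simp
  then obtain m where m: "(C / q) ^ m < 1 / (V + 1)"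
    using real_arch_pow_inv[of "1 / (V + 1)" "C / q"] V0 by auto
  define R where "R = h ^ m * v"
  have Rz: "norm (cpoly R (?z ^ i)) < 1" for i
  proof -
    \<comment> \<open>Where \<open>f\<close> vanishes, the Frobenius relation reduces to
      \<open>q * h(z) = - f(z ^ q)\<close>; at the other roots of unity \<open>v\<close> vanishes
      and both sides are \<open>0\<close>.\<close>
    have "of_nat q * cpoly h (?z ^ i) * cpoly v (?z ^ i) = - cpoly f (?z ^ (i * q)) * cpoly v (?z ^ i)"
      using vf[OF zn, of i] hz[of "?z ^ i"] q0 
      by (cases "cpoly f (?z ^ i) = 0") (auto simp: power_mult zero_power algebra_simps)
    then have "(of_nat q * cpoly h (?z ^ i)) ^ m * cpoly v (?z ^ i) 
        = (- cpoly f (?z ^ (i * q))) ^ m * cpoly v (?z ^ i)"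
      by (cases "cpoly v (?z ^ i) = 0") (simp, metis mult_right_cancel)
    then have "real q ^ m * norm (cpoly R (?z ^ i)) = norm (cpoly f (?z ^ (i * q))) ^ m * norm (cpoly v (?z ^ i))"
      unfolding R_def of_int_poly_hom.hom_mult of_int_poly_hom.hom_power poly_mult poly_power
      by (metis (no_types, opaque_lifting) mult.assoc norm_minus_cancel norm_mult norm_of_nat norm_power power_mult_distrib)
    also have "\<dots> \<le> C ^ m * V" by (intro mult_mono power_mono C V zero_le_power C0 norm_ge_zero)
    finally have "norm (cpoly R (?z ^ i)) \<le> (C / q) ^ m * V"
      using q0 by (simp add: power_divide field_simps)
    also have "\<dots> \<le> (1 / (V + 1)) * V" using m V0 by (intro mult_right_mono) auto
    also have "\<dots> < 1" using V0 by simp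
    finally show ?thesis .
  qed
  have "cpoly R (?z ^ (j mod n)) = 0"
  proof (rule fourier_inversion[OF n])
    fix r assume r: "r < n"
    obtain c where c: "(\<Sum>i<n. cpoly R (?z ^ i) * ?z ^ (i * (n - r))) = of_nat n * of_int c"
      using fourier_coefficient_int[OF n, of R r] by auto
    \<comment> \<open>A sum of \<open>n\<close> terms of norm below \<open>1\<close> cannot be a
      nonzero integer multiple of \<open>n\<close>.\<close>
    have "norm (of_nat n * of_int c :: complex) < (\<Sum>i<n. 1)"
      unfolding c[symmetric] using n Rz
      by (intro le_less_trans[OF norm_sum] sum_strict_mono) (auto simp: norm_mult norm_power)
    then have "real n * \<bar>of_int c\<bar> < real n * 1" by (simp add: norm_mult)
    then have "c = 0" using n by (simp add: mult_less_cancel_left)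
    then show "(\<Sum>i<n. cpoly R (?z ^ i) * ?z ^ (i * (n - r))) = 0" using c by simp
  qed (use n in simp)
  then have "cpoly R (?z ^ j) = 0" by (simp add: unity_root_power_mod n)
  then have "cpoly h (?z ^ j) = 0"
    using v by (auto simp: R_def of_int_poly_hom.hom_mult of_int_poly_hom.hom_power)
  then show ?thesis using hz[of "?z ^ j"] root q0 by (simp add: power_mult zero_power)
qed

text \<open>An elementary stand-in for Dirichlet's theorem: it is enough that all prime factors of
  \<open>J\<close> are large. The witness adds to \<open>j\<close> the product of \<open>m\<close>
  and the small primes not dividing \<open>j\<close>; every small prime then divides exactly one of
  the two summands.\<close>

lemma exists_cong_avoiding_primes:
  fixes j m B :: nat
  assumes "m > 0" "coprime j m"
  obtains J where "J > 0" "[J = j] (mod m)" "\<And>r. prime r \<Longrightarrow> r dvd J \<Longrightarrow> r > B"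
proof -
  define T where "T = {r. prime r \<and> r \<le> B \<and> \<not> r dvd j}"
  have fT: "finite T" unfolding T_def by simp
  have avoid: "\<not> r dvd j + m * \<Prod>T" if r: "prime r" "r \<le> B" for r
  proof (cases "r dvd j")
    case True
    then have "\<not> r dvd m" using assms(2) r(1) by (meson coprime_common_divisor not_prime_unit)
    moreover have "\<not> r dvd \<Prod>T"
    proof
      assume "r dvd \<Prod>T"
      then obtain t where "t \<in> T" "r dvd t" using r(1) fT by (auto simp: prime_dvd_prod_iff)
      then have "r = t" using r(1) by (simp add: T_def primes_dvd_imp_eq)
      then show False using True \<open>t \<in> T\<close> by (simp add: T_def)
    qed
    ultimately have "\<not> r dvd m * \<Prod>T" using r(1) by (simp add: prime_dvd_mult_iff)
    then show ?thesis using True by (simp add: dvd_add_right_iff)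
  next
    case False
    then have "r \<in> T" using r by (simp add: T_def)
    then have "r dvd \<Prod>T" using fT by (simp add: dvd_prod_eqI)
    then have "r dvd m * \<Prod>T" by simp
    then show ?thesis using False by (simp add: dvd_add_left_iff)
  qed
  have "\<Prod>T > 0" using fT by (intro prod_pos) (auto simp: T_def prime_gt_0_nat)
  then have "j + m * \<Prod>T > 0" using assms(1) by simp
  moreover have "[j + m * \<Prod>T = j] (mod m)" by (simp add: cong_def)
  ultimately show ?thesis using avoid that[of "j + m * \<Prod>T"] by (meson not_le)
qed

text \<open>The large-prime step requires primes above the coefficient sum. So \<open>j\<close> is
  replaced by a congruent exponent all of whose prime factors are that large, and these are applied
  one after another.\<close>

lemma cpoly_root_power_coprime:
  fixes f :: "int poly"
  assumes n: "n > 0" and j: "coprime j n" and root: "cpoly f (unity_root n) = 0"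
  shows "cpoly f (unity_root n ^ j) = 0"
proof -
  define B where "B = nat (\<Sum>i\<le>degree f. \<bar>coeff f i\<bar>)"
  obtain J where J: "J > 0" "[J = j] (mod n)" "\<And>r. prime r \<Longrightarrow> r dvd J \<Longrightarrow> r > B"
    using exists_cong_avoiding_primes[OF n j] by blast
  have "cpoly f (unity_root n ^ (i * K)) = 0" 
    if "K > 0" "\<And>r. prime r \<Longrightarrow> r dvd K \<Longrightarrow> r > B" "cpoly f (unity_root n ^ i) = 0" for i K
    using that
  proof (induction K arbitrary: i rule: less_induct)
    case (less K)
    show ?case
    proof (cases "K = 1")
      case False
      then obtain q where q: "prime q" "q dvd K" using prime_factor_nat by blast
      then obtain K' where K': "K = q * K'" by blast
      have "B < q" using less.prems(2) q by blast
      then have "(\<Sum>i\<le>degree f. \<bar>coeff f i\<bar>) < int q" unfolding B_def by linarith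
      then have "cpoly f (unity_root n ^ (i * q)) = 0"
        using cpoly_root_power_large_prime[OF n q(1)] less.prems(3) by blast
      moreover have "0 < K'" "K' < K" using K' less.prems(1) prime_gt_1_nat[OF q(1)] by auto
      ultimately have "cpoly f (unity_root n ^ (i * q * K')) = 0"
        using less.IH[of K' "i * q"] less.prems(2) K' by simp
      then show ?thesis using K' by (simp add: mult.assoc)
    qed (use less.prems in simp)
  qed
  from this[of J 1] have "cpoly f (unity_root n ^ J) = 0" using J root by simp
  then show ?thesis using unity_root_power_cong[OF n J(2)] by simp
qed

section \<open>Vanishing sums split by residue classes of the exponents\<close>

lemma sum_lessThan_mult_split:
  fixes f :: "nat \<Rightarrow> 'a::comm_monoid_add"
  shows "(\<Sum>a<p * m. f a) = (\<Sum>r<p. \<Sum>b<m. f (r + p * b))"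
proof (cases "p = 0")
  case False
  have "(\<Sum>r<p. \<Sum>b<m. f (r + p * b)) = (\<Sum>z\<in>{..<p} \<times> {..<m}. f (fst z + p * snd z))"
    by (simp add: sum.cartesian_product case_prod_unfold)
  also have "\<dots> = (\<Sum>a<p * m. f a)"
  proof (rule sum.reindex_bij_witness[of _ "\<lambda>a. (a mod p, a div p)" "\<lambda>z. fst z + p * snd z"])
    fix z assume z: "z \<in> {..<p} \<times> {..<m}"
    have "p * Suc (snd z) \<le> p * m" using z by (intro mult_le_mono2) auto
    then show "fst z + p * snd z \<in> {..<p * m}" using z by auto
  next
    fix a assume "a \<in> {..<p * m}"
    then show "(a mod p, a div p) \<in> {..<p} \<times> {..<m}"
      using False by (auto simp: div_less_iff_less_mult mult.commute)
  qed (use False in auto)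
  finally show ?thesis by simp
qed simp

text \<open>With \<open>n = p * m\<close>, the residue class \<open>r\<close> of exponents modulo
  \<open>p\<close> contributes \<open>?z ^ r * s r\<close>, where \<open>s r\<close> is a sum of
  \<open>m\<close>-th roots of unity. Once every \<open>s r\<close> is zero, induction applies to
  each class. As the sum is shorter than \<open>p\<close>, some class is empty; this supplies the
  one equation that conjugation cannot give.\<close>

theorem short_vanishing_sum_trivial:
  fixes c :: "nat \<Rightarrow> int"
  assumes "n > 0" "(\<Sum>a<n. of_int (c a) * unity_root n ^ a) = 0"
    and "\<And>p. prime p \<Longrightarrow> p dvd n \<Longrightarrow> (\<Sum>a<n. \<bar>c a\<bar>) < int p" and "a < n"
  shows "c a = 0"
  using assms
proof (induction n arbitrary: c a rule: less_induct)
  case (less n)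
  note n = less.prems(1)
  show ?case
  proof (cases "n = 1")
    case True
    then show ?thesis using less.prems by simp
  next
    case False
    then obtain p where p: "prime p" "p dvd n" using prime_factor_nat by blast
    then obtain m where m: "n = p * m" by blast
    have p0: "p > 0" using p prime_gt_0_nat by blast
    have m0: "m > 0" "m < n" using m n prime_gt_1_nat[OF p(1)] by auto
    let ?z = "unity_root n"
    have zp: "?z ^ p = unity_root m" and zm: "?z ^ m = unity_root p"
      unfolding m using unity_root_mult_power[OF p0 m0(1)] unity_root_mult_power[OF m0(1) p0]
      by (simp_all add: mult.commute)
    define s where "s r = (\<Sum>b<m. of_int (c (r + p * b)) * unity_root m ^ b)" for r
    \<comment> \<open>\<open>F t\<close> is the conjugate of the given sum under \<open>\<zeta> \<mapsto> \<zeta>\<^bsup>1 + t m\<^esup>\<close> whenever that exponent is a unit, which fails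
      for at most one \<open>t < p\<close>; inverting the Fourier transform in \<open>t\<close> separates the residue classes modulo \<open>p\<close>.\<close>
    define F where "F t = (\<Sum>a<n. of_int (c a) * (?z ^ (1 + t * m)) ^ a)" for t
    have F: "F t = (\<Sum>r<p. unity_root p ^ (t * r) * (?z ^ r * s r))" for t
    proof -
      have "of_int (c (r + p * b)) * (?z ^ (1 + t * m)) ^ (r + p * b)
          = unity_root p ^ (t * r) * (?z ^ r * (of_int (c (r + p * b)) * unity_root m ^ b))" for r b
      proof -
        have "(?z ^ (1 + t * m)) ^ (r + p * b) = ?z ^ r * (?z ^ p) ^ b * (?z ^ m) ^ (t * r) * (?z ^ n) ^ (t * b)"
        proof -
          have e: "(1 + t * m) * (r + p * b) = r + p * b + m * (t * r) + n * (t * b)"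
            unfolding m by (simp add: algebra_simps)
          have "(?z ^ (1 + t * m)) ^ (r + p * b) = ?z ^ (r + p * b + m * (t * r) + n * (t * b))"
            unfolding e[symmetric] by (rule power_mult[symmetric])
          then show ?thesis by (simp only: power_add power_mult)
        qed
        then show ?thesis unfolding zp zm unity_root_power_self[OF n] by simp
      qed
      then show ?thesis unfolding F_def s_def m sum_lessThan_mult_split sum_distrib_left
        by (intro sum.cong refl) simp
    qed
    \<comment> \<open>\<open>1 + t * m\<close> is coprime to \<open>m\<close>, so \<open>p\<close>
      is the only prime that it can share with \<open>n\<close>.\<close>
    have ndm: "\<not> r dvd m" if "prime r" "r dvd 1 + t * m" for r t
    proof
      assume "r dvd m"
      then have "r dvd t * m" by simp
      then have "r dvd 1" using that(2) dvd_add_left_iff by blast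
      then show False using that(1) by simp
    qed
    have F0: "F t = 0" if t: "\<not> p dvd 1 + t * m" for t
    proof -
      define f :: "int poly" where "f = (\<Sum>a<n. monom (c a) a)"
      have fz: "cpoly f z = (\<Sum>a<n. of_int (c a) * z ^ a)" for z
        unfolding f_def of_int_poly_hom.hom_sum poly_sum by (simp add: poly_monom)
      have "coprime (1 + t * m) n"
      proof (rule ccontr)
        assume "\<not> coprime (1 + t * m) n"
        then have "gcd (1 + t * m) n \<noteq> 1" by (simp add: coprime_iff_gcd_eq_1)
        then obtain r where r: "prime r" "r dvd gcd (1 + t * m) n" using prime_factor_nat by blast
        then have rd: "r dvd 1 + t * m" "r dvd p * m" unfolding m by auto
        have "r dvd p" using rd(2) ndm[OF r(1) rd(1)] r(1) by (simp add: prime_dvd_mult_iff)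
        then have "r = p" using r(1) p(1) by (simp add: primes_dvd_imp_eq)
        then show False using rd t by blast
      qed
      then show ?thesis
        using cpoly_root_power_coprime[OF n, of "1 + t * m" f] less.prems(2) unfolding fz F_def by simp
    qed
    obtain r0 where r0: "r0 < p" "s r0 = 0"
    proof -
      have "\<exists>r0<p. \<forall>b<m. c (r0 + p * b) = 0"
      proof (rule ccontr)
        assume A: "\<not> (\<exists>r0<p. \<forall>b<m. c (r0 + p * b) = 0)"
        have "(\<Sum>r<p. 1) \<le> (\<Sum>r<p. \<Sum>b<m. \<bar>c (r + p * b)\<bar>)"
        proof (rule sum_mono)
          fix r assume "r \<in> {..<p}"
          then obtain b where b: "b < m" "c (r + p * b) \<noteq> 0" using A by auto
          then have "1 \<le> \<bar>c (r + p * b)\<bar>" by linarith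
          also have "\<dots> \<le> (\<Sum>b<m. \<bar>c (r + p * b)\<bar>)" using b by (intro member_le_sum) auto
          finally show "1 \<le> (\<Sum>b<m. \<bar>c (r + p * b)\<bar>)" .
        qed
        then have "int p \<le> (\<Sum>a<n. \<bar>c a\<bar>)" unfolding m sum_lessThan_mult_split by simp
        then show False using less.prems(3)[OF p] by simp
      qed
      then obtain r0 where "r0 < p" "\<forall>b<m. c (r0 + p * b) = 0" by blast
      then show ?thesis by (intro that[of r0]) (simp_all add: s_def)
    qed
    have inv: "(\<Sum>t<p. F t * unity_root p ^ (t * (p - r))) = of_nat p * (?z ^ r * s r)" if r: "r < p" for r
    proof -
      have "(\<Sum>t<p. F t * unity_root p ^ (t * (p - r)))
          = (\<Sum>r'<p. (?z ^ r' * s r') * (\<Sum>t<p. unity_root p ^ (t * (r' + (p - r)))))"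
        unfolding F sum_distrib_left sum_distrib_right
        by (subst sum.swap) (simp add: distrib_left power_add mult_ac)
      also have "\<dots> = (\<Sum>r'<p. if r = r' then of_nat p * (?z ^ r' * s r') else 0)"
      proof (intro sum.cong refl)
        fix r' assume r': "r' \<in> {..<p}"
        have "p dvd r' + (p - r) \<longleftrightarrow> r = r'"
        proof
          assume "p dvd r' + (p - r)"
          then obtain q where q: "r' + (p - r) = p * q" by (elim dvdE)
          have "0 < r' + (p - r)" "r' + (p - r) < p * 2" using r r' by auto
          then have "0 < q" "q < 2" unfolding q by (auto simp: mult_less_cancel1)
          then have "q = 1" by simp
          then show "r = r'" using q r by auto
        qed (use r in auto)
        then show "(?z ^ r' * s r') * (\<Sum>t<p. unity_root p ^ (t * (r' + (p - r))))
            = (if r = r' then of_nat p * (?z ^ r' * s r') else 0)"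
          unfolding sum_unity_root_power[OF p0] by auto
      qed
      also have "\<dots> = of_nat p * (?z ^ r * s r)" using r by simp
      finally show ?thesis .
    qed
    \<comment> \<open>If \<open>F t\<close> were the only nonzero value, its inverse transform would
      be \<open>F t\<close> times a root of unity in every class, but it is zero at the empty class
      \<open>r0\<close>.\<close>
    have Fz: "F t = 0" if t: "t < p" for t
    proof (rule ccontr)
      assume Ft: "F t \<noteq> 0"
      have pt: "p dvd 1 + t * m" using F0 Ft by blast
      have "F t' = 0" if t': "t' < p" "t' \<noteq> t" for t'
      proof (rule ccontr)
        assume "F t' \<noteq> 0"
        then have "p dvd 1 + t' * m" using F0 by blast
        then have "int p dvd (1 + int t * int m) - (1 + int t' * int m)"
          using pt by (intro dvd_diff) (simp_all flip: of_nat_mult of_nat_Suc)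
        then have "int p dvd (int t - int t') * int m" by (simp add: algebra_simps)
        moreover have "\<not> p dvd m" using ndm[OF p(1) pt] .
        ultimately have "int p dvd int t - int t'" using p(1) by (simp add: prime_dvd_mult_iff)
        then show False using dvd_imp_le_int[of "int t - int t'" "int p"] t t' by auto
      qed
      then have "(\<Sum>t'<p. F t' * unity_root p ^ (t' * (p - r0))) = F t * unity_root p ^ (t * (p - r0))"
        using t by (subst sum.remove[of _ t]) auto
      then show False using inv[OF r0(1)] r0(2) Ft by simp
    qed
    have sz: "s r = 0" if "r < p" for r
    proof -
      have "of_nat p * (?z ^ r * s r) = 0" using inv[OF that] Fz by simp
      then show ?thesis using p0 by simp
    qed
    have "c (a mod p + p * (a div p)) = 0"
    proof (rule less.IH[OF m0(2,1), of "\<lambda>b. c (a mod p + p * b)" "a div p"])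
      show "(\<Sum>b<m. of_int (c (a mod p + p * b)) * unity_root m ^ b) = 0"
        using sz[of "a mod p"] p0 unfolding s_def by simp
      show "(\<Sum>b<m. \<bar>c (a mod p + p * b)\<bar>) < int q" if q: "prime q" "q dvd m" for q
      proof -
        have "(\<Sum>b<m. \<bar>c (a mod p + p * b)\<bar>) \<le> (\<Sum>r<p. \<Sum>b<m. \<bar>c (r + p * b)\<bar>)"
          using p0 by (intro member_le_sum[of "a mod p" "{..<p}" "\<lambda>r. \<Sum>b<m. \<bar>c (r + p * b)\<bar>"])
            (auto simp: sum_nonneg)
        also have "\<dots> = (\<Sum>a<n. \<bar>c a\<bar>)" unfolding m sum_lessThan_mult_split ..
        also have "\<dots> < int q" using less.prems(3)[of q] q m by simp
        finally show ?thesis .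
      qed
      show "a div p < m" using less.prems(4) m p0 by (simp add: div_less_iff_less_mult mult.commute)
    qed
    then show ?thesis by simp
  qed
qed

section \<open>Circulant matrices\<close>

lemma zero_one_circulant_entry:
  assumes "zero_one_circulant n A" "i < n" "j < n"
  shows "A $$ (i, j) = (if (j + (n - i)) mod n \<in> circulant_support A then 1 else 0)"
proof -
  have n: "n > 0" using assms by simp
  have c: "A \<in> carrier_mat n n" using assms(1) by (simp add: zero_one_circulant_def)
  let ?d = "(j + (n - i)) mod n"
  have d: "?d < n" using n by simp
  have "(int j - int i) mod int n = (int ?d - int 0) mod int n"
  proof -
    have "int ?d = (int j - int i + int n) mod int n"
      using assms(2) by (simp add: zmod_int of_nat_diff algebra_simps)
    then show ?thesis by simp
  qed
  then have "A $$ (i, j) = A $$ (0, ?d)"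
    using assms n d unfolding zero_one_circulant_def by blast
  moreover have "A $$ (0, ?d) \<in> {0, 1}" using assms(1) n d unfolding zero_one_circulant_def by blast
  ultimately show ?thesis using c d by (auto simp: circulant_support_def)
qed

lemma mod_add_diff_cancel:
  fixes d i n :: nat
  assumes "i < n" "d < n"
  shows "((d + i) mod n + (n - i)) mod n = d"
proof -
  have "((d + i) mod n + (n - i)) mod n = (d + i + (n - i)) mod n" by (simp add: mod_simps)
  also have "d + i + (n - i) = d + n" using assms by simp
  finally show ?thesis using assms by simp
qed

lemma mod_diff_add_cancel:
  fixes d i n :: nat
  assumes "i < n" "d < n"
  shows "((d + (n - i)) mod n + i) mod n = d"
proof -
  have "((d + (n - i)) mod n + i) mod n = (d + (n - i) + i) mod n" by (simp add: mod_simps)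
  also have "d + (n - i) + i = d + n" using assms by simp
  finally show ?thesis using assms by simp
qed

lemma mod_diff_diff_cancel:
  fixes d m n :: nat
  assumes "m < n" "d < n"
  shows "(m + (n - (m + (n - d)) mod n)) mod n = d"
proof -
  let ?i = "(m + (n - d)) mod n"
  have i: "?i < n" using assms by simp
  have ii: "int ?i = (int m + int n - int d) mod int n"
    using assms by (simp add: zmod_int of_nat_diff algebra_simps)
  have "int (m + (n - ?i)) = int m - int ?i + int n" using i by (simp add: of_nat_diff)
  then have "int ((m + (n - ?i)) mod n) = (int m - int ?i + int n) mod int n" by (metis zmod_int)
  also have "\<dots> = (int m - int ?i) mod int n" by (rule mod_add_self2)
  also have "\<dots> = (int m - (int m + int n - int d)) mod int n" unfolding ii by (rule mod_diff_right_eq)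
  also have "int m - (int m + int n - int d) = int d - int n" by simp
  also have "(int d - int n) mod int n = int d mod int n" by simp
  finally show ?thesis using assms by (simp add: zmod_int[symmetric])
qed

context
  fixes n k :: nat and A :: "complex mat" and a :: "nat \<Rightarrow> nat"
  assumes A: "zero_one_circulant n A" and a: "bij_betw a {..<k} (circulant_support A)"
begin

lemma circulant_carrier: "A \<in> carrier_mat n n"
  using A by (simp add: zero_one_circulant_def)

lemma circulant_support_less: "circulant_support A \<subseteq> {..<n}"
  using circulant_carrier by (auto simp: circulant_support_def)

lemma sum_support: "(\<Sum>d<n. (if d \<in> circulant_support A then 1 else 0) * g d) = (\<Sum>i<k. g (a i))"
  for g :: "nat \<Rightarrow> complex"
proof -
  have "(\<Sum>d<n. (if d \<in> circulant_support A then 1 else 0) * g d) = (\<Sum>d\<in>circulant_support A. g d)"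
    using circulant_support_less by (intro sum.mono_neutral_cong_right) auto
  also have "\<dots> = (\<Sum>i<k. g (a i))" by (rule sum.reindex_bij_betw[OF a, symmetric])
  finally show ?thesis .
qed

text \<open>Characters of the cyclic group are eigenvectors of every circulant; the substitution of
  \<open>d + i\<close> for the column moves row \<open>i\<close> to the top row.\<close>

lemma circulant_mult_fourier:
  "A *\<^sub>v vec n (\<lambda>i. unity_root n ^ (j * i)) = 
     (\<Sum>s<k. unity_root n ^ (j * a s)) \<cdot>\<^sub>v vec n (\<lambda>i. unity_root n ^ (j * i))"
proof (rule eq_vecI)
  let ?z = "unity_root n"
  fix i assume "i < dim_vec ((\<Sum>s<k. ?z ^ (j * a s)) \<cdot>\<^sub>v vec n (\<lambda>i. ?z ^ (j * i)))"
  then have i: "i < n" by simp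
  then have n: "n > 0" by simp
  let ?S = "circulant_support A"
  have "(A *\<^sub>v vec n (\<lambda>i. ?z ^ (j * i))) $ i = (\<Sum>m<n. A $$ (i, m) * ?z ^ (j * m))"
    using i circulant_carrier by (simp add: scalar_prod_def atLeast0LessThan)
  also have "\<dots> = (\<Sum>m<n. (if (m + (n - i)) mod n \<in> ?S then 1 else 0) * ?z ^ (j * m))"
    by (intro sum.cong refl arg_cong2[of _ _ _ _ "(*)"]) (simp add: zero_one_circulant_entry[OF A i])
  also have "\<dots> = (\<Sum>d<n. (if d \<in> ?S then 1 else 0) * ?z ^ (j * (d + i)))"
  proof (rule sum.reindex_bij_witness[of _ "\<lambda>d. (d + i) mod n" "\<lambda>m. (m + (n - i)) mod n"])
    fix m assume m: "m \<in> {..<n}"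
    show "((m + (n - i)) mod n + i) mod n = m" using mod_diff_add_cancel i m by simp
    have "[(m + (n - i)) mod n + i = m] (mod n)" 
      using mod_diff_add_cancel[OF i, of m] m by (simp add: cong_def)
    then have "[j * ((m + (n - i)) mod n + i) = j * m] (mod n)" by (intro cong_mult cong_refl)
    then show "(if (m + (n - i)) mod n \<in> ?S then 1 else 0) * ?z ^ (j * ((m + (n - i)) mod n + i))
        = (if (m + (n - i)) mod n \<in> ?S then 1 else 0) * ?z ^ (j * m)"
      by (simp only: unity_root_power_cong[OF n])
  qed (use i mod_add_diff_cancel in auto)
  also have "\<dots> = (\<Sum>s<k. ?z ^ (j * (a s + i)))" by (rule sum_support)
  also have "\<dots> = ((\<Sum>s<k. ?z ^ (j * a s)) \<cdot>\<^sub>v vec n (\<lambda>i. ?z ^ (j * i))) $ i"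
    using i by (simp add: sum_distrib_right distrib_left power_add)
  finally show "(A *\<^sub>v vec n (\<lambda>i. ?z ^ (j * i))) $ i = \<dots>" .
qed (use circulant_carrier in auto)

lemma circulant_transpose_mult_fourier:
  "transpose_mat A *\<^sub>v vec n (\<lambda>i. unity_root n ^ (j * i)) = 
     (\<Sum>s<k. unity_root n ^ (j * (n - a s))) \<cdot>\<^sub>v vec n (\<lambda>i. unity_root n ^ (j * i))"
proof (rule eq_vecI)
  let ?z = "unity_root n"
  fix m assume "m < dim_vec ((\<Sum>s<k. ?z ^ (j * (n - a s))) \<cdot>\<^sub>v vec n (\<lambda>i. ?z ^ (j * i)))"
  then have m: "m < n" by simp
  then have n: "n > 0" by simp
  let ?S = "circulant_support A"
  have "(transpose_mat A *\<^sub>v vec n (\<lambda>i. ?z ^ (j * i))) $ m = (\<Sum>i<n. A $$ (i, m) * ?z ^ (j * i))"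
    using m circulant_carrier by (simp add: scalar_prod_def atLeast0LessThan)
  also have "\<dots> = (\<Sum>i<n. (if (m + (n - i)) mod n \<in> ?S then 1 else 0) * ?z ^ (j * i))"
    by (intro sum.cong refl arg_cong2[of _ _ _ _ "(*)"]) (simp add: zero_one_circulant_entry[OF A _ m])
  also have "\<dots> = (\<Sum>d<n. (if d \<in> ?S then 1 else 0) * ?z ^ (j * (m + (n - d))))"
  proof (rule sum.reindex_bij_witness[of _ "\<lambda>d. (m + (n - d)) mod n" "\<lambda>i. (m + (n - i)) mod n"])
    fix i assume i: "i \<in> {..<n}"
    show "(m + (n - (m + (n - i)) mod n)) mod n = i" using mod_diff_diff_cancel m i by simp
    have "[m + (n - (m + (n - i)) mod n) = i] (mod n)" 
      using mod_diff_diff_cancel[OF m, of i] i by (simp add: cong_def)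
    then have "[j * (m + (n - (m + (n - i)) mod n)) = j * i] (mod n)" by (intro cong_mult cong_refl)
    then show "(if (m + (n - i)) mod n \<in> ?S then 1 else 0) * ?z ^ (j * (m + (n - (m + (n - i)) mod n)))
        = (if (m + (n - i)) mod n \<in> ?S then 1 else 0) * ?z ^ (j * i)"
      by (simp only: unity_root_power_cong[OF n])
  qed (use m mod_diff_diff_cancel in auto)
  also have "\<dots> = (\<Sum>s<k. ?z ^ (j * (m + (n - a s))))" by (rule sum_support)
  also have "\<dots> = ((\<Sum>s<k. ?z ^ (j * (n - a s))) \<cdot>\<^sub>v vec n (\<lambda>i. ?z ^ (j * i))) $ m"
    using m by (simp add: sum_distrib_left distrib_left power_add mult.commute)
  finally show "(transpose_mat A *\<^sub>v vec n (\<lambda>i. ?z ^ (j * i))) $ m = \<dots>" .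
qed (use circulant_carrier in auto)

text \<open>The eigenvalues of the two factors multiply, and the product expands into a sum over all
  pairs, diagonal included. The natural number \<open>a (fst z) + (n - a (snd z))\<close> represents
  a difference modulo \<open>n\<close>.\<close>

lemma circulant_gram_mult_fourier:
  "(A * transpose_mat A) *\<^sub>v vec n (\<lambda>i. unity_root n ^ (j * i)) = 
     (\<Sum>z\<in>{..<k} \<times> {..<k}. unity_root n ^ (j * (a (fst z) + (n - a (snd z))))) 
       \<cdot>\<^sub>v vec n (\<lambda>i. unity_root n ^ (j * i))"
proof -
  let ?w = "vec n (\<lambda>i. unity_root n ^ (j * i))"
  have "(A * transpose_mat A) *\<^sub>v ?w = A *\<^sub>v (transpose_mat A *\<^sub>v ?w)"
    using circulant_carrier by (intro assoc_mult_mat_vec) auto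
  also have "\<dots> = (\<Sum>s<k. unity_root n ^ (j * (n - a s))) \<cdot>\<^sub>v (A *\<^sub>v ?w)"
    unfolding circulant_transpose_mult_fourier using circulant_carrier by (intro mult_mat_vec) auto
  also have "\<dots> = ((\<Sum>s<k. unity_root n ^ (j * (n - a s))) * (\<Sum>s<k. unity_root n ^ (j * a s))) \<cdot>\<^sub>v ?w"
    unfolding circulant_mult_fourier by (simp add: smult_smult_assoc)
  also have "(\<Sum>s<k. unity_root n ^ (j * (n - a s))) * (\<Sum>s<k. unity_root n ^ (j * a s))
      = (\<Sum>z\<in>{..<k} \<times> {..<k}. unity_root n ^ (j * (a (fst z) + (n - a (snd z)))))"
    by (subst mult.commute) (simp add: sum_product sum.cartesian_product case_prod_unfold distrib_left power_add)
  finally show ?thesis .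
qed

end

text \<open>The character with \<open>j = 1\<close> is an eigenvector of
  \<open>A * transpose_mat A\<close>, and \<open>Q\<close> carries it to an eigenvector
  \<open>u\<close> of \<open>B * transpose_mat B\<close>. Since \<open>u\<close> is nonzero, some
  Fourier vector pairs nontrivially with it. The pairing is bilinear, without conjugation, so
  symmetry of the matrix forces the two eigenvalues to agree.\<close>

lemma similar_circulant_gram_imp_eigenvalue_eq:
  fixes A B :: "complex mat" and a b :: "nat \<Rightarrow> nat"
  assumes n: "n > 0" and A: "zero_one_circulant n A" and a: "bij_betw a {..<k} (circulant_support A)"
    and B: "zero_one_circulant n B" and b: "bij_betw b {..<k} (circulant_support B)"
    and sim: "similar_mat (A * transpose_mat A) (B * transpose_mat B)"
  shows "\<exists>j. (\<Sum>z\<in>{..<k} \<times> {..<k}. unity_root n ^ (a (fst z) + (n - a (snd z))))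
    = (\<Sum>z\<in>{..<k} \<times> {..<k}. unity_root n ^ (j * (b (fst z) + (n - b (snd z)))))"
proof -
  let ?z = "unity_root n"
  let ?X = "A * transpose_mat A" and ?Y = "B * transpose_mat B"
  let ?w = "\<lambda>j. vec n (\<lambda>i. ?z ^ (j * i))"
  have cA: "A \<in> carrier_mat n n" and cB: "B \<in> carrier_mat n n" 
    using A B by (simp_all add: zero_one_circulant_def)
  have cX: "?X \<in> carrier_mat n n" and cY: "?Y \<in> carrier_mat n n" using cA cB by auto
  obtain P Q where "similar_mat_wit ?X ?Y P Q" using sim unfolding similar_mat_def by blast
  from similar_mat_witD2[OF cX this]
  have PQ: "P * Q = 1\<^sub>m n" "Q * P = 1\<^sub>m n" "?X = P * ?Y * Q"
    and c: "P \<in> carrier_mat n n" "Q \<in> carrier_mat n n" by auto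
  define l where "l = (\<Sum>z\<in>{..<k} \<times> {..<k}. ?z ^ (a (fst z) + (n - a (snd z))))"
  define u where "u = Q *\<^sub>v ?w 1"
  have cu: "u \<in> carrier_vec n" using c by (simp add: u_def)
  have Xw: "?X *\<^sub>v ?w 1 = l \<cdot>\<^sub>v ?w 1" 
    using circulant_gram_mult_fourier[OF A a, of 1] by (simp add: l_def)
  have "Q * ?X = ?Y * Q"
  proof -
    have "Q * ?X = Q * (P * (?Y * Q))" 
      using PQ(3) assoc_mult_mat[OF c(1) cY c(2)] by simp
    also have "\<dots> = (Q * P) * (?Y * Q)"
      using assoc_mult_mat[OF c(2) c(1), of "?Y * Q" n] cY c(2) mult_carrier_mat by metis
    also have "\<dots> = ?Y * Q" using PQ(2) left_mult_one_mat[of "?Y * Q" n n] cY c(2) mult_carrier_mat by metis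
    finally show ?thesis .
  qed
  then have Yu: "?Y *\<^sub>v u = l \<cdot>\<^sub>v u"
  proof -
    assume QX: "Q * ?X = ?Y * Q"
    have "?Y *\<^sub>v u = (?Y * Q) *\<^sub>v ?w 1"
      unfolding u_def using assoc_mult_mat_vec[OF cY c(2)] by simp
    also have "\<dots> = Q *\<^sub>v (?X *\<^sub>v ?w 1)" 
      unfolding QX[symmetric] using assoc_mult_mat_vec[OF c(2) cX] by simp
    also have "\<dots> = l \<cdot>\<^sub>v u" unfolding Xw u_def using mult_mat_vec[OF c(2)] by simp
    finally show ?thesis .
  qed
  have "\<exists>r<n. ?w (n - r) \<bullet> u \<noteq> 0"
  proof (rule ccontr)
    assume "\<not> ?thesis"
    then have "(\<Sum>i<n. u $ i * ?z ^ (i * (n - r))) = 0" if "r < n" for r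
      using that cu by (auto simp: scalar_prod_def atLeast0LessThan mult.commute)
    then have "u $ i = 0" if "i < n" for i using fourier_inversion[OF n _ that] by blast
    then have u0: "u = 0\<^sub>v n" using cu by (intro eq_vecI) auto
    have "?w 1 = P *\<^sub>v u" 
      unfolding u_def using assoc_mult_mat_vec[OF c, of "?w 1"] PQ(1) by simp
    also have "\<dots> = 0\<^sub>v n" unfolding u0 using c(1) by (intro eq_vecI) auto
    finally have "?w 1 = 0\<^sub>v n" .
    then have "?w 1 $ 0 = 0\<^sub>v n $ 0" by simp
    then show False using n by simp
  qed
  then obtain j where j: "?w j \<bullet> u \<noteq> 0" by blast
  define m where "m = (\<Sum>z\<in>{..<k} \<times> {..<k}. ?z ^ (j * (b (fst z) + (n - b (snd z)))))"
  have Yw: "?Y *\<^sub>v ?w j = m \<cdot>\<^sub>v ?w j" 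
    using circulant_gram_mult_fourier[OF B b, of j] by (simp add: m_def)
  have symY: "transpose_mat ?Y = ?Y" 
    using transpose_mult[OF cB, of "transpose_mat B" n] cB by simp
  have "m * (?w j \<bullet> u) = (?Y *\<^sub>v ?w j) \<bullet> u" unfolding Yw using cu by simp
  also have "\<dots> = (transpose_mat ?Y *\<^sub>v ?w j) \<bullet> u" unfolding symY ..
  also have "\<dots> = ?w j \<bullet> (?Y *\<^sub>v u)"
    using transpose_vec_mult_scalar[OF cY cu, of "?w j"] by simp
  also have "\<dots> = l * (?w j \<bullet> u)" unfolding Yu using cu by simp
  finally have "m = l" using j by simp
  then show ?thesis unfolding m_def l_def by (intro exI[of _ j]) (erule sym)
qed

text \<open>The \<open>k\<close> diagonal pairs contribute \<open>1\<close> each on both sides and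
  cancel. This leaves \<open>k * (k - 1)\<close> roots of unity per side, so the absolute
  coefficients of the difference add up to at most \<open>2 * k * (k - 1)\<close>.\<close>

lemma unity_root_sum_eq_imp_image_mset_eq:
  fixes F G :: "nat \<times> nat \<Rightarrow> nat"
  assumes n: "n > 0" "\<And>p. prime p \<Longrightarrow> p dvd n \<Longrightarrow> p > 2 * k * (k - 1)"
    and eq: "(\<Sum>z\<in>{..<k} \<times> {..<k}. unity_root n ^ F z) = (\<Sum>z\<in>{..<k} \<times> {..<k}. unity_root n ^ G z)"
    and diag: "\<And>i. i < k \<Longrightarrow> n dvd F (i, i)" "\<And>i. i < k \<Longrightarrow> n dvd G (i, i)"
  shows "image_mset (\<lambda>z. F z mod n) (mset_set ({..<k} \<times> {..<k}))
       = image_mset (\<lambda>z. G z mod n) (mset_set ({..<k} \<times> {..<k}))"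
proof -
  let ?z = "unity_root n"
  define D where "D = (\<lambda>i. (i, i)) ` {..<k}"
  define E where "E = {..<k} \<times> {..<k} - D"
  have DE: "{..<k} \<times> {..<k} = D \<union> E" "D \<inter> E = {}" by (auto simp: D_def E_def)
  have fin: "finite D" "finite E" by (simp_all add: D_def E_def)
  have "card D = k" unfolding D_def by (subst card_image) (auto simp: inj_on_def)
  then have "card E = k * k - k" unfolding E_def
    by (subst card_Diff_subset) (use fin in \<open>auto simp: D_def card_cartesian_product\<close>)
  then have cE: "2 * card E = 2 * k * (k - 1)" by (simp add: diff_mult_distrib2)
  have dz: "?z ^ F z = 1" "?z ^ G z = 1" "F z mod n = 0" "G z mod n = 0" if "z \<in> D" for z
    using that diag n(1) by (auto simp: D_def unity_root_power_eq_1_iff)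
  have split: "sum f ({..<k} \<times> {..<k}) = sum f D + sum f E" for f :: "nat \<times> nat \<Rightarrow> complex"
    unfolding DE(1) using fin DE(2) by (rule sum.union_disjoint)
  have "(\<Sum>z\<in>D. ?z ^ F z) = (\<Sum>z\<in>D. ?z ^ G z)" using dz by (intro sum.cong) auto
  then have eqE: "(\<Sum>z\<in>E. ?z ^ F z) = (\<Sum>z\<in>E. ?z ^ G z)" using eq unfolding split by simp
  define cnt where "cnt H a = card {z \<in> E. H z mod n = a}" for H :: "nat \<times> nat \<Rightarrow> nat" and a
  have cnt_sum: "(\<Sum>a<n. of_nat (cnt H a) * ?z ^ a) = (\<Sum>z\<in>E. ?z ^ H z)" for H
  proof -
    have "(\<Sum>a<n. of_nat (cnt H a) * ?z ^ a) = (\<Sum>a<n. \<Sum>z\<in>{z \<in> E. H z mod n = a}. ?z ^ H z)"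
    proof (intro sum.cong refl)
      fix a
      have "(\<Sum>z\<in>{z \<in> E. H z mod n = a}. ?z ^ H z) = (\<Sum>z\<in>{z \<in> E. H z mod n = a}. ?z ^ a)"
        by (rule sum.cong) (auto simp: unity_root_power_mod[OF n(1)])
      then show "of_nat (cnt H a) * ?z ^ a = (\<Sum>z\<in>{z \<in> E. H z mod n = a}. ?z ^ H z)"
        by (simp add: cnt_def)
    qed
    also have "\<dots> = (\<Sum>z\<in>E. ?z ^ H z)" by (rule sum.group) (use fin n in auto)
    finally show ?thesis .
  qed
  have cnt_card: "(\<Sum>a<n. cnt H a) = card E" for H
  proof -
    have "(\<Sum>a<n. cnt H a) = (\<Sum>a<n. \<Sum>z\<in>{z \<in> E. H z mod n = a}. 1)" by (simp add: cnt_def)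
    also have "\<dots> = (\<Sum>z\<in>E. 1)" by (rule sum.group) (use fin n in auto)
    finally show ?thesis by simp
  qed
  define c where "c a = int (cnt F a) - int (cnt G a)" for a
  have c0: "c a = 0" if "a < n" for a
  proof (rule short_vanishing_sum_trivial[OF n(1)])
    have "(\<Sum>a<n. of_int (c a) * ?z ^ a) = (\<Sum>a<n. of_nat (cnt F a) * ?z ^ a) - (\<Sum>a<n. of_nat (cnt G a) * ?z ^ a)"
      by (simp add: c_def left_diff_distrib sum_subtractf)
    then show "(\<Sum>a<n. of_int (c a) * ?z ^ a) = 0" unfolding cnt_sum eqE by simp
    fix p assume p: "prime p" "p dvd n"
    have "(\<Sum>a<n. \<bar>c a\<bar>) \<le> (\<Sum>a<n. int (cnt F a) + int (cnt G a))"
      by (rule sum_mono) (simp add: c_def)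
    also have "\<dots> = int (2 * card E)"
      using cnt_card[of F] cnt_card[of G] by (simp add: sum.distrib flip: of_nat_sum)
    also have "\<dots> < int p" unfolding cE of_nat_less_iff by (rule n(2)[OF p])
    finally show "(\<Sum>a<n. \<bar>c a\<bar>) < int p" .
  qed (rule that)
  have "image_mset (\<lambda>z. F z mod n) (mset_set E) = image_mset (\<lambda>z. G z mod n) (mset_set E)"
  proof (rule multiset_eqI)
    fix a
    have "cnt F a = cnt G a"
    proof (cases "a < n")
      case True
      then show ?thesis using c0[OF True] by (simp add: c_def)
    next
      case False
      then have "{z \<in> E. H z mod n = a} = {}" for H using n(1) by auto
      then show ?thesis by (simp only: cnt_def)
    qed
    then show "count (image_mset (\<lambda>z. F z mod n) (mset_set E)) a
        = count (image_mset (\<lambda>z. G z mod n) (mset_set E)) a"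
      using fin by (simp add: count_image_mset_eq_card_vimage cnt_def)
  qed
  moreover have "image_mset (\<lambda>z. F z mod n) (mset_set D) = image_mset (\<lambda>z. G z mod n) (mset_set D)"
    using dz fin by (intro image_mset_cong) auto
  ultimately show ?thesis unfolding DE(1) using fin DE(2) by (simp add: mset_set_Union)
qed

text \<open>The exponent \<open>j\<close> from the eigenvalue comparison need not be prime to
  \<open>n\<close>, for the differences of \<open>b\<close> may share a divisor with
  \<open>n\<close>. Comparing in both directions shows that \<open>j\<close> is invertible as far as
  these differences can detect, and it is then exchanged for a unit.\<close>

lemma similar_circulant_gram_imp_affine:
  fixes A B :: "complex mat"
  assumes k: "k \<in> {4, 5}" and n: "n > 0" "\<And>p. prime p \<Longrightarrow> p dvd n \<Longrightarrow> p > 2 * k * (k - 1)"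
    and A: "zero_one_circulant n A" "circulant_weight A = k"
    and B: "zero_one_circulant n B" "circulant_weight B = k"
    and sim: "similar_mat (A * transpose_mat A) (B * transpose_mat B)"
  shows "\<exists>u<n. \<exists>v<n. gcd u n = 1 \<and> circulant_support A = affine_image_mod n u v (circulant_support B)"
proof -
  let ?K = "{..<k}"
  have supp: "circulant_support A \<subseteq> {..<n}" "circulant_support B \<subseteq> {..<n}"
    using A(1) B(1) by (auto simp: circulant_support_def zero_one_circulant_def)
  have finS: "finite (circulant_support A)" "finite (circulant_support B)" 
    using supp finite_subset by blast+
  obtain a where a: "bij_betw a ?K (circulant_support A)"
    using ex_bij_betw_nat_finite[OF finS(1)] A(2) by (auto simp: circulant_weight_def atLeast0LessThan)
  obtain b where b: "bij_betw b ?K (circulant_support B)"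
    using ex_bij_betw_nat_finite[OF finS(2)] B(2) by (auto simp: circulant_weight_def atLeast0LessThan)
  have an: "a i < n" and bn: "b i < n" if "i < k" for i
    using bij_betw_apply[OF a] bij_betw_apply[OF b] supp that by auto
  define ga where "ga z = a (fst z) + (n - a (snd z))" for z
  define gb where "gb z = b (fst z) + (n - b (snd z))" for z
  have ga_diag: "n dvd ga (i, i)" and gb_diag: "n dvd gb (i, i)" if "i < k" for i
    using an[OF that] bn[OF that] by (simp_all add: ga_def gb_def)
  obtain j where "(\<Sum>z\<in>?K \<times> ?K. unity_root n ^ ga z) = (\<Sum>z\<in>?K \<times> ?K. unity_root n ^ (j * gb z))"
    using similar_circulant_gram_imp_eigenvalue_eq[OF n(1) A(1) a B(1) b sim] by (auto simp: ga_def gb_def)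
  then have ab: "image_mset (\<lambda>z. ga z mod n) (mset_set (?K \<times> ?K)) 
      = image_mset (\<lambda>z. j * gb z mod n) (mset_set (?K \<times> ?K))"
    by (intro unity_root_sum_eq_imp_image_mset_eq n) (auto simp: ga_diag gb_diag)
  obtain j' where "(\<Sum>z\<in>?K \<times> ?K. unity_root n ^ gb z) = (\<Sum>z\<in>?K \<times> ?K. unity_root n ^ (j' * ga z))"
    using similar_circulant_gram_imp_eigenvalue_eq[OF n(1) B(1) b A(1) a similar_mat_sym[OF sim]] 
    by (auto simp: ga_def gb_def)
  then have ba: "image_mset (\<lambda>z. gb z mod n) (mset_set (?K \<times> ?K)) 
      = image_mset (\<lambda>z. j' * ga z mod n) (mset_set (?K \<times> ?K))"
    by (intro unity_root_sum_eq_imp_image_mset_eq n) (auto simp: ga_diag gb_diag)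
  have toB: "\<exists>y\<in>?K \<times> ?K. ga x mod n = j * gb y mod n" if "x \<in> ?K \<times> ?K" for x
  proof -
    have "ga z mod n \<in> (\<lambda>z. ga z mod n) ` (?K \<times> ?K)" if "z \<in> ?K \<times> ?K" for z 
      using that by (rule imageI)
    moreover have "(\<lambda>z. ga z mod n) ` (?K \<times> ?K) = (\<lambda>z. j * gb z mod n) ` (?K \<times> ?K)"
      using arg_cong[OF ab, of set_mset] by simp
    ultimately show ?thesis using that by blast
  qed
  have toA: "\<exists>y\<in>?K \<times> ?K. gb x mod n = j' * ga y mod n" if "x \<in> ?K \<times> ?K" for x
  proof -
    have "gb z mod n \<in> (\<lambda>z. gb z mod n) ` (?K \<times> ?K)" if "z \<in> ?K \<times> ?K" for z 
      using that by (rule imageI)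
    moreover have "(\<lambda>z. gb z mod n) ` (?K \<times> ?K) = (\<lambda>z. j' * ga z mod n) ` (?K \<times> ?K)"
      using arg_cong[OF ba, of set_mset] by simp
    ultimately show ?thesis using that by blast
  qed
  define g where "g = Gcd (insert n (gb ` (?K \<times> ?K)))"
  have gn: "g dvd n" unfolding g_def by (rule Gcd_dvd) simp
  have gy: "g dvd gb y" if "y \<in> ?K \<times> ?K" for y 
    unfolding g_def by (rule Gcd_dvd, rule insertI2, rule imageI, rule that)
  obtain m where m: "n = g * m" using gn by blast
  have g0: "g > 0" and m0: "m > 0" using m n(1) by auto
  \<comment> \<open>Only the class of \<open>j\<close> modulo \<open>n / g\<close> matters, and every difference of \<open>b\<close> is \<open>j j'\<close> times another one.\<close>
  have "coprime j m"
  proof (rule ccontr)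
    assume "\<not> coprime j m"
    then have "gcd j m \<noteq> 1" by (simp add: coprime_iff_gcd_eq_1)
    then obtain r where r: "prime r" "r dvd gcd j m" using prime_factor_nat by blast
    then have rj: "r dvd j" and rm: "r dvd m" by auto
    have rn: "r * g dvd n" unfolding m using rm by (simp add: mult.commute)
    \<comment> \<open>The passage from \<open>b\<close> to \<open>a\<close> and back brings in the
      factor \<open>j\<close>, divisible by \<open>r\<close>, while \<open>gb w\<close> is divisible
      by \<open>g\<close>. So \<open>r * g\<close> would be a common divisor larger than
      \<open>g\<close>.\<close>
    have "r * g dvd gb x" if x: "x \<in> ?K \<times> ?K" for x
    proof -
      obtain y where y: "y \<in> ?K \<times> ?K" "[gb x = j' * ga y] (mod n)" using toA[OF x] by (auto simp: cong_def)
      obtain w where w: "w \<in> ?K \<times> ?K" "[ga y = j * gb w] (mod n)" using toB[OF y(1)] by (auto simp: cong_def)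
      have "[gb x = j' * (j * gb w)] (mod n)" 
        using y(2) cong_mult[OF cong_refl w(2)] by (rule cong_trans)
      then have "[gb x = j' * (j * gb w)] (mod r * g)" using rn by (rule cong_dvd_modulus_nat)
      moreover have "r * g dvd j' * (j * gb w)" using rj gy[OF w(1)] by (simp add: mult_dvd_mono)
      ultimately show ?thesis using cong_dvd_iff by blast
    qed
    then have "r * g dvd g" using rn unfolding g_def by (intro Gcd_greatest) (auto simp del: mem_Sigma_iff)
    then have "r dvd 1" using g0 by simp
    then show False using r(1) by simp
  qed
  \<comment> \<open>All prime factors of \<open>J\<close> exceed \<open>n\<close>, so
    \<open>J\<close> is a unit modulo \<open>n\<close> and not only modulo \<open>m\<close>.\<close>
  then obtain J where J: "J > 0" "[J = j] (mod m)" "\<And>r. prime r \<Longrightarrow> r dvd J \<Longrightarrow> r > n"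
    using exists_cong_avoiding_primes[OF m0] by blast
  have cop: "coprime J n"
  proof (rule ccontr)
    assume "\<not> coprime J n"
    then have "gcd J n \<noteq> 1" by (simp add: coprime_iff_gcd_eq_1)
    then obtain r where r: "prime r" "r dvd gcd J n" using prime_factor_nat by blast
    then have "r dvd J" "r dvd n" by auto
    then show False using J(3)[OF r(1)] dvd_imp_le[of r n] n(1) by auto
  qed
  have Jj: "j * gb z mod n = J * gb z mod n" if z: "z \<in> ?K \<times> ?K" for z
  proof -
    obtain t where t: "gb z = g * t" using gy[OF z] by blast
    have "[int j = int J] (mod int m)" using cong_sym[OF J(2)] by (simp only: cong_int_iff)
    then have "int m dvd int j - int J" by (simp only: cong_iff_dvd_diff)
    then have "int g * int m dvd int g * ((int j - int J) * int t)" by (intro mult_dvd_mono) auto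
    then have "[int (j * gb z) = int (J * gb z)] (mod int n)"
      unfolding m t cong_iff_dvd_diff by (simp add: algebra_simps)
    then show ?thesis unfolding cong_int_iff unfolding cong_def .
  qed
  have aJb: "image_mset (\<lambda>z. ga z mod n) (mset_set (?K \<times> ?K)) 
      = image_mset (\<lambda>z. J * gb z mod n) (mset_set (?K \<times> ?K))"
    unfolding ab
  proof (rule image_mset_cong)
    fix z assume "z \<in># mset_set (?K \<times> ?K)"
    then have "z \<in> ?K \<times> ?K" by (simp only: finite_set_mset_mset_set finite_cartesian_product finite_lessThan)
    then show "j * gb z mod n = J * gb z mod n" by (rule Jj)
  qed
  have "finite (?K \<times> ?K)" by simp
  then obtain \<sigma> where \<sigma>: "\<sigma> permutes ?K \<times> ?K" "\<forall>z\<in>?K \<times> ?K. ga z mod n = J * gb (\<sigma> z) mod n"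
    by (rule image_mset_eq_implies_permutes[OF _ aJb])
  have \<sigma>b: "bij_betw \<sigma> (?K \<times> ?K) (?K \<times> ?K)" using permutes_imp_bij[OF \<sigma>(1)] .
  define b' where "b' i = int J * int (b i)" for i
  have cong: "[int (a (fst z)) - int (a (snd z)) = b' (fst (\<sigma> z)) - b' (snd (\<sigma> z))] (mod int n)"
    if z: "z \<in> ?K \<times> ?K" for z
  proof -
    have \<sigma>z: "\<sigma> z \<in> ?K \<times> ?K" using bij_betw_apply[OF \<sigma>b z] .
    have ia: "int (ga z) = int (a (fst z)) - int (a (snd z)) + int n"
      using an[of "snd z"] z by (simp add: ga_def mem_Times_iff)
    have ib: "int (J * gb (\<sigma> z)) = b' (fst (\<sigma> z)) - b' (snd (\<sigma> z)) + int J * int n"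
      using bn[of "snd (\<sigma> z)"] \<sigma>z by (simp add: gb_def b'_def mem_Times_iff distrib_left right_diff_distrib)
    have "[int (ga z) = int (J * gb (\<sigma> z))] (mod int n)"
      using bspec[OF \<sigma>(2) z] unfolding cong_int_iff unfolding cong_def .
    then show ?thesis unfolding ia ib cong_def by simp
  qed
  have n2k: "p > 2 ^ k" if "prime p" "p dvd n" for p
    using n(2)[OF that] k by auto
  obtain s \<pi> v where s: "s \<in> {1, -1 :: int}" and \<pi>: "bij_betw \<pi> ?K ?K" 
    and av: "\<And>i. i < k \<Longrightarrow> [int (a i) = s * b' (\<pi> i) + v] (mod int n)"
    using homometric_mod[OF k n(1) n2k \<sigma>b, of "\<lambda>i. int (a i)" b', OF _ _ cong] by blast
  \<comment> \<open>The sign merges into the multiplier. For \<open>n = 1\<close> this gives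
    \<open>u = 0\<close>, in keeping with \<open>gcd 0 1 = 1\<close>.\<close>
  define u where "u = nat ((s * int J) mod int n)"
  define w where "w = nat (v mod int n)"
  have iu: "int u = (s * int J) mod int n" and iw: "int w = v mod int n"
    using n(1) by (simp_all add: u_def w_def)
  have uw: "u < n" "w < n" using n(1) by (simp_all add: u_def w_def nat_less_iff)
  have "coprime (s * int J) (int n)" using s cop by auto
  then have "coprime (int u) (int n)" unfolding iu using n(1) by (simp add: coprime_mod_left_iff)
  then have cu: "gcd u n = 1" by (simp add: coprime_iff_gcd_eq_1)
  have ai: "a i = (u * b (\<pi> i) + w) mod n" if i: "i < k" for i
  proof -
    have "[int (u * b (\<pi> i) + w) = s * int J * int (b (\<pi> i)) + v] (mod int n)"
      unfolding of_nat_add of_nat_mult iu iw by (intro cong_add cong_mult cong_refl) (simp_all add: cong_def)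
    then have "[int (u * b (\<pi> i) + w) = int (a i)] (mod int n)"
      using cong_sym[OF av[OF i]] cong_trans unfolding b'_def mult.assoc by blast
    then have "(u * b (\<pi> i) + w) mod n = a i mod n" unfolding cong_int_iff unfolding cong_def .
    then show ?thesis using an[OF i] by simp
  qed
  have "circulant_support A = a ` ?K" using a by (simp add: bij_betw_def)
  also have "\<dots> = (\<lambda>i. (u * b (\<pi> i) + w) mod n) ` ?K" by (intro image_cong refl ai) simp
  also have "\<dots> = affine_image_mod n u w (b ` (\<pi> ` ?K))" by (simp add: affine_image_mod_def image_image)
  also have "b ` (\<pi> ` ?K) = circulant_support B" using b \<pi> by (simp add: bij_betw_def)
  finally show ?thesis using uw cu by (intro exI[of _ u] exI[of _ w] conjI)
qed

section \<open>Permutation matrices and the consequences of affine equivalence\<close>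

lemma permutation_mat_carrier: "permutation_mat n P \<Longrightarrow> P \<in> carrier_mat n n"
  by (auto simp: permutation_mat_def)

lemma permutation_mat_mult_transpose:
  fixes P :: "'a::field mat"
  assumes "permutation_mat n P"
  shows "P * transpose_mat P = 1\<^sub>m n" "transpose_mat P * P = 1\<^sub>m n"
proof -
  obtain \<pi> where \<pi>: "\<pi> permutes {..<n}" and P: "P = mat n n (\<lambda>(i, j). if j = \<pi> i then 1 else 0)"
    using assms unfolding permutation_mat_def by blast
  have \<pi>n: "\<pi> i < n" if "i < n" for i using permutes_in_image[OF \<pi>, of i] that by simp
  have inj: "\<pi> i = \<pi> j \<longleftrightarrow> i = j" for i j using permutes_inj[OF \<pi>] by (auto dest: injD)
  have "(P * transpose_mat P) $$ (i, j) = (if i = j then 1 else 0)" if ij: "i < n" "j < n" for i j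
  proof -
    have "(P * transpose_mat P) $$ (i, j) 
        = (\<Sum>m<n. (if m = \<pi> i then 1 else 0) * (if m = \<pi> j then 1 else 0))"
      using ij by (simp add: P scalar_prod_def atLeast0LessThan)
    also have "\<dots> = (\<Sum>m<n. if m = \<pi> i then if i = j then 1 else 0 else 0)"
      by (rule sum.cong) (auto simp: inj)
    also have "\<dots> = (if i = j then 1 else 0)" using \<pi>n[OF ij(1)] by simp
    finally show ?thesis .
  qed
  then show PPt: "P * transpose_mat P = 1\<^sub>m n" by (intro eq_matI) (auto simp: P)
  show "transpose_mat P * P = 1\<^sub>m n"
    by (rule mat_mult_left_right_inverse[OF _ _ PPt]) (auto simp: P)
qed

text \<open>Left multiplication selects row \<open>\<pi> i\<close>, whereas right multiplication
  moves column \<open>l\<close> to \<open>\<tau> l\<close>; naming the column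
  \<open>\<tau> l\<close> avoids an inverse permutation.\<close>

lemma permutation_mat_mult_mult_index:
  fixes B :: "'a::idom mat"
  assumes \<pi>: "\<pi> permutes {..<n}" and \<tau>: "\<tau> permutes {..<n}" and B: "B \<in> carrier_mat n n"
    and "i < n" "l < n"
  shows "(mat n n (\<lambda>(i, j). if j = \<pi> i then 1 else 0) * B * mat n n (\<lambda>(i, j). if j = \<tau> i then 1 else 0)) $$ (i, \<tau> l)
    = B $$ (\<pi> i, l)"
proof -
  let ?P = "mat n n (\<lambda>(i, j). if j = \<pi> i then 1 else 0 :: 'a)"
  let ?Q = "mat n n (\<lambda>(i, j). if j = \<tau> i then 1 else 0 :: 'a)"
  have \<pi>n: "\<pi> i < n" using permutes_in_image[OF \<pi>, of i] assms by simp
  have \<tau>n: "\<tau> l < n" using permutes_in_image[OF \<tau>, of l] assms by simp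
  have inj: "\<tau> l = \<tau> m \<longleftrightarrow> m = l" for m using permutes_inj[OF \<tau>] by (auto dest: injD)
  have PB: "(?P * B) $$ (i, m) = B $$ (\<pi> i, m)" if "m < n" for m
  proof -
    have "(?P * B) $$ (i, m) = (\<Sum>x<n. (if x = \<pi> i then 1 else 0) * B $$ (x, m))"
      using assms that by (simp add: scalar_prod_def atLeast0LessThan)
    also have "\<dots> = (\<Sum>x<n. if x = \<pi> i then B $$ (x, m) else 0)" by (rule sum.cong) auto
    also have "\<dots> = B $$ (\<pi> i, m)" using \<pi>n by simp
    finally show ?thesis .
  qed
  have "(?P * B * ?Q) $$ (i, \<tau> l) = (\<Sum>m<n. (?P * B) $$ (i, m) * (if m = l then 1 else 0))"
    using assms \<tau>n inj by (simp add: scalar_prod_def atLeast0LessThan)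
  also have "\<dots> = (\<Sum>m<n. if m = l then B $$ (\<pi> i, m) else 0)" by (rule sum.cong) (auto simp: PB)
  also have "\<dots> = B $$ (\<pi> i, l)" using assms by simp
  finally show ?thesis .
qed

lemma affine_permutes:
  assumes "n > 0" "coprime u n"
  shows "(\<lambda>i. if i < n then (u * i + v) mod n else i) permutes {..<n :: nat}"
proof (rule bij_imp_permutes)
  let ?f = "\<lambda>i. if i < n then (u * i + v) mod n else i"
  have "inj_on ?f {..<n}"
  proof (rule inj_onI)
    fix i j assume ij: "i \<in> {..<n}" "j \<in> {..<n}" "?f i = ?f j"
    then have "[u * i + v = u * j + v] (mod n)" by (simp add: cong_def)
    then have "[u * i = u * j] (mod n)" by (simp only: cong_add_rcancel_nat)
    then have "[i = j] (mod n)" using cong_mult_lcancel_nat[OF assms(2)] by blast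
    then show "i = j" using ij by (simp add: cong_def)
  qed
  moreover have "?f ` {..<n} \<subseteq> {..<n}" using assms by auto
  ultimately show "bij_betw ?f {..<n} {..<n}"
    unfolding bij_betw_def using endo_inj_surj[of "{..<n}" ?f] by blast
qed auto

text \<open>Rows are moved by \<open>i -> u * i\<close> and columns by
  \<open>l -> u * l + v\<close>, so that column minus row changes from \<open>d\<close> to
  \<open>u * d + v\<close>, which carries the support of \<open>B\<close> onto that of
  \<open>A\<close>.\<close>

lemma affine_supports_imp_permutation_equivalent:
  fixes A B :: "'a::idom mat"
  assumes n: "n > 0" and A: "zero_one_circulant n A" and B: "zero_one_circulant n B"
    and u: "gcd u n = 1" and supp: "circulant_support A = affine_image_mod n u v (circulant_support B)"
  shows "\<exists>P Q. permutation_mat n P \<and> permutation_mat n Q \<and> A = P * B * Q"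
proof -
  have cA: "A \<in> carrier_mat n n" and cB: "B \<in> carrier_mat n n"
    using A B by (simp_all add: zero_one_circulant_def)
  have cop: "coprime u n" using u by (simp add: coprime_iff_gcd_eq_1)
  define \<sigma> where "\<sigma> = (\<lambda>i. if i < n then (u * i + 0) mod n else i)"
  define \<tau> where "\<tau> = (\<lambda>i. if i < n then (u * i + v) mod n else i)"
  have \<sigma>: "\<sigma> permutes {..<n}" unfolding \<sigma>_def by (rule affine_permutes[OF n cop])
  have \<tau>: "\<tau> permutes {..<n}" unfolding \<tau>_def by (rule affine_permutes[OF n cop])
  have entry: "A $$ (\<sigma> i, \<tau> l) = B $$ (i, l)" if il: "i < n" "l < n" for i l
  proof -
    have \<sigma>n: "\<sigma> i < n" and \<tau>n: "\<tau> l < n" using n il by (simp_all add: \<sigma>_def \<tau>_def)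
    have "int ((\<tau> l + (n - \<sigma> i)) mod n) = (int (\<tau> l) - int (\<sigma> i)) mod int n"
    proof -
      have "int (\<tau> l + (n - \<sigma> i)) = int (\<tau> l) - int (\<sigma> i) + int n" using \<sigma>n by simp
      then show ?thesis by (metis zmod_int mod_add_self2)
    qed
    also have "\<dots> = (int (u * l + v) - int (u * i)) mod int n"
      using il by (simp add: \<sigma>_def \<tau>_def zmod_int mod_diff_eq)
    also have "\<dots> = (int (u * l + v) - int (u * i) + int u * int n) mod int n" by simp
    also have "int (u * l + v) - int (u * i) + int u * int n = int (u * (l + (n - i)) + v)"
      using il by (simp add: of_nat_diff ring_distribs)
    finally have e: "(\<tau> l + (n - \<sigma> i)) mod n = (u * (l + (n - i)) + v) mod n"
      by (metis zmod_int of_nat_eq_iff)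
    define d where "d = (l + (n - i)) mod n"
    have d: "d < n" using n by (simp add: d_def)
    have "(u * (l + (n - i)) + v) mod n = (u * d + v) mod n"
      unfolding d_def cong_def[symmetric] by (intro cong_add cong_mult cong_refl) (simp add: cong_def)
    then have e2: "(\<tau> l + (n - \<sigma> i)) mod n = \<tau> d" using e d by (simp add: \<tau>_def)
    have SB: "circulant_support B \<subseteq> {..<n}" using cB by (auto simp: circulant_support_def)
    have SA: "circulant_support A = \<tau> ` circulant_support B"
      unfolding supp affine_image_mod_def using SB by (intro image_cong) (auto simp: \<tau>_def)
    have "\<tau> d \<in> circulant_support A \<longleftrightarrow> d \<in> circulant_support B"
      unfolding SA using permutes_inj[OF \<tau>] by (auto dest: injD)
    then show ?thesis
      unfolding zero_one_circulant_entry[OF A \<sigma>n \<tau>n] zero_one_circulant_entry[OF B il] e2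
      by (simp add: d_def)
  qed
  \<comment> \<open>\<open>P\<close> selects rows of \<open>B\<close> and therefore takes the
    inverse of \<open>\<sigma>\<close>, while \<open>Q\<close> moves columns forward and takes
    \<open>\<tau>\<close> itself.\<close>
  define P where "P = mat n n (\<lambda>(i, j). if j = inv_into UNIV \<sigma> i then 1 else 0 :: 'a)"
  define Q where "Q = mat n n (\<lambda>(i, j). if j = \<tau> i then 1 else 0 :: 'a)"
  have PQ: "permutation_mat n P" "permutation_mat n Q"
    unfolding permutation_mat_def P_def Q_def using permutes_inv[OF \<sigma>] \<tau> by blast+
  have "A = P * B * Q"
  proof (rule eq_matI)
    fix i j assume "i < dim_row (P * B * Q)" "j < dim_col (P * B * Q)"
    then have ij: "i < n" "j < n" by (simp_all add: P_def Q_def)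
    have i': "inv_into UNIV \<sigma> i < n" "\<sigma> (inv_into UNIV \<sigma> i) = i" 
      using permutes_in_image[OF permutes_inv[OF \<sigma>], of i] permutes_inverses(1)[OF \<sigma>] ij by auto
    have j': "inv_into UNIV \<tau> j < n" "\<tau> (inv_into UNIV \<tau> j) = j" 
      using permutes_in_image[OF permutes_inv[OF \<tau>], of j] permutes_inverses(1)[OF \<tau>] ij by auto
    have "(P * B * Q) $$ (i, \<tau> (inv_into UNIV \<tau> j)) = B $$ (inv_into UNIV \<sigma> i, inv_into UNIV \<tau> j)"
      unfolding P_def Q_def by (rule permutation_mat_mult_mult_index[OF permutes_inv[OF \<sigma>] \<tau> cB ij(1) j'(1)])
    also have "\<dots> = A $$ (i, j)" using entry[OF i'(1) j'(1)] unfolding i'(2) j'(2) by simp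
    finally show "A $$ (i, j) = (P * B * Q) $$ (i, j)" unfolding j'(2) by simp
  qed (use cA in \<open>auto simp: P_def Q_def\<close>)
  then show ?thesis using PQ by blast
qed

lemma permutation_equivalent_imp_gram_conjugate:
  fixes A B :: "'a::field mat"
  assumes B: "B \<in> carrier_mat n n" and P: "permutation_mat n P" and Q: "permutation_mat n Q"
    and A: "A = P * B * Q"
  shows "A * transpose_mat A = P * (B * transpose_mat B) * transpose_mat P"
proof -
  note cP = permutation_mat_carrier[OF P] and cQ = permutation_mat_carrier[OF Q]
  let ?Pt = "transpose_mat P" and ?Bt = "transpose_mat B" and ?Qt = "transpose_mat Q"
  have c: "?Pt \<in> carrier_mat n n" "?Bt \<in> carrier_mat n n" "?Qt \<in> carrier_mat n n" using cP cQ B by auto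
  have At: "transpose_mat A = ?Qt * (?Bt * ?Pt)"
    unfolding A using transpose_mult[OF _ cQ, of "P * B" n] transpose_mult[OF cP B] cP B by simp
  have "A * transpose_mat A = (P * B) * (Q * (?Qt * (?Bt * ?Pt)))"
    unfolding At unfolding A by (rule assoc_mult_mat[of _ n n]) (use cP B cQ c in auto)
  also have "Q * (?Qt * (?Bt * ?Pt)) = (Q * ?Qt) * (?Bt * ?Pt)"
    by (rule assoc_mult_mat[symmetric, of _ n n]) (use cQ c in auto)
  also have "\<dots> = ?Bt * ?Pt" unfolding permutation_mat_mult_transpose(1)[OF Q] using c by simp
  also have "(P * B) * (?Bt * ?Pt) = ((P * B) * ?Bt) * ?Pt"
    by (rule assoc_mult_mat[symmetric, of _ n n]) (use cP B c in auto)
  also have "(P * B) * ?Bt = P * (B * ?Bt)" by (rule assoc_mult_mat[of _ n n]) (use cP B c in auto)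
  finally show ?thesis .
qed

theorem theorem7p3:
  fixes k n :: nat
    and A B :: "complex mat"
  assumes "k \<in> {4, 5}"
    and "n \<ge> 1"
    and "\<forall>p. prime p \<and> p dvd n \<longrightarrow> p > 2 * k * (k - 1)"
    and "zero_one_circulant n A"
    and "zero_one_circulant n B"
    and "circulant_weight A = k"
    and "circulant_weight B = k"
  defines "c1 \<equiv> \<exists>u<n. \<exists>v<n. gcd u n = 1 \<and>
                  circulant_support A = affine_image_mod n u v (circulant_support B)"
    and "c2 \<equiv> \<exists>P Q. permutation_mat n P \<and> permutation_mat n Q \<and> A = P * B * Q"
    and "c3 \<equiv> \<exists>P R. permutation_mat n P \<and> R \<in> carrier_mat n n \<and>
                  inverts_mat P R \<and> inverts_mat R P \<and>
                  A * transpose_mat A = P * (B * transpose_mat B) * R"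
    and "c4 \<equiv> similar_mat (A * transpose_mat A) (B * transpose_mat B)"
  shows "(c1 \<longleftrightarrow> c2) \<and> (c2 \<longleftrightarrow> c3) \<and> (c3 \<longleftrightarrow> c4)"
proof -
  have n: "n > 0" using assms(2) by simp
  have cA: "A \<in> carrier_mat n n" and cB: "B \<in> carrier_mat n n"
    using assms(4,5) by (simp_all add: zero_one_circulant_def)
  have "c2" if Hc1: "c1"
  proof -
    obtain u v where "gcd u n = 1" "circulant_support A = affine_image_mod n u v (circulant_support B)"
      using Hc1 unfolding c1_def by auto
    then show ?thesis
      unfolding c2_def by (rule affine_supports_imp_permutation_equivalent[OF n assms(4,5)])
  qed
  moreover have "c3" if Hc2: "c2"
  proof -
    obtain P Q where P: "permutation_mat n P" and Q: "permutation_mat n Q" and A: "A = P * B * Q"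
      using Hc2 unfolding c2_def by blast
    note cP = permutation_mat_carrier[OF P]
    show ?thesis unfolding c3_def
      using P cP permutation_mat_mult_transpose[OF P] permutation_equivalent_imp_gram_conjugate[OF cB P Q A]
      by (intro exI[of _ P] exI[of _ "transpose_mat P"]) (auto simp: inverts_mat_def)
  qed
  moreover have "c4" if Hc3: "c3"
  proof -
    obtain P R where P: "permutation_mat n P" and R: "R \<in> carrier_mat n n"
      and PR: "inverts_mat P R" "inverts_mat R P" "A * transpose_mat A = P * (B * transpose_mat B) * R"
      using Hc3 unfolding c3_def by blast
    show ?thesis unfolding c4_def
      by (rule similar_matI[of _ _ P R n])
        (use permutation_mat_carrier[OF P] R PR cA cB in \<open>auto simp: inverts_mat_def\<close>)
  qed
  moreover have "c1" if "c4"
    using that similar_circulant_gram_imp_affine[OF assms(1) n _ assms(4,6,5,7)] assms(3)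
    unfolding c1_def c4_def by blast
  ultimately show ?thesis by blast
qed

end
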